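(* Every planar graph $G$ satisfies $$\chi(G)\le \left\lceil\frac{\omega(G)+Z(G)+1}{2}\right\rceil.$$
   Context: All graphs are finite, undirected and simple. $\chi(G)$ denotes the chromatic number of $G$ and $\omega(G)$ its clique number. Zero forcing number: let each vertex of $G$ be initially coloured black or white. Colour-change rule: if a black vertex $u$ has exactly one white neighbour $v$, then $v$ may be recoloured black ($u$ forces $v$). A set $B\subseteq V(G)$ is a zero forcing set if, starting with exactly the vertices of $B$ black, repeated application of the colour-change rule makes every vertex of $G$ black. The zero forcing number $Z(G)$ is the minimum size of a zero forcing set of $G$. *)

theory Defs
  imports "HOL-Analysis.Analysis"
begin

text \<open>
  A graph is given by its vertex set and its set of edges, each edge being the
  two-element set of its end vertices.
\<close>

definition finite_simple_graph :: "'a set \<Rightarrow> 'a set set \<Rightarrow> bool" where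
  "finite_simple_graph V E \<longleftrightarrow> finite V \<and> (\<forall>e\<in>E. e \<subseteq> V \<and> card e = 2)"

definition proper_colouring :: "'a set \<Rightarrow> 'a set set \<Rightarrow> nat \<Rightarrow> ('a \<Rightarrow> nat) \<Rightarrow> bool" where
  "proper_colouring V E k c \<longleftrightarrow>
     (\<forall>v\<in>V. c v < k) \<and> (\<forall>u\<in>V. \<forall>v\<in>V. {u, v} \<in> E \<longrightarrow> c u \<noteq> c v)"

definition chromatic_number :: "'a set \<Rightarrow> 'a set set \<Rightarrow> nat" where
  "chromatic_number V E = (LEAST k. \<exists>c. proper_colouring V E k c)"

definition clique :: "'a set \<Rightarrow> 'a set set \<Rightarrow> 'a set \<Rightarrow> bool" where
  "clique V E K \<longleftrightarrow> K \<subseteq> V \<and> (\<forall>u\<in>K. \<forall>v\<in>K. u \<noteq> v \<longrightarrow> {u, v} \<in> E)"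

definition clique_number :: "'a set \<Rightarrow> 'a set set \<Rightarrow> nat" where
  "clique_number V E = Max (card ` {K. clique V E K})"

definition forces :: "'a set \<Rightarrow> 'a set set \<Rightarrow> 'a set \<Rightarrow> 'a \<Rightarrow> 'a \<Rightarrow> bool" where
  "forces V E B u v \<longleftrightarrow> u \<in> B \<and> {w \<in> V. {u, w} \<in> E \<and> w \<notin> B} = {v}"

text \<open>
  The argument \<open>B\<close> of \<open>forces\<close> and the two related sets below are the sets of black vertices.
\<close>

definition colour_change :: "'a set \<Rightarrow> 'a set set \<Rightarrow> 'a set \<Rightarrow> 'a set \<Rightarrow> bool" where
  "colour_change V E B B' \<longleftrightarrow> (\<exists>u v. forces V E B u v \<and> B' = insert v B)"

definition zero_forcing_set :: "'a set \<Rightarrow> 'a set set \<Rightarrow> 'a set \<Rightarrow> bool" where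
  "zero_forcing_set V E B \<longleftrightarrow> B \<subseteq> V \<and> (colour_change V E)\<^sup>*\<^sup>* B V"

definition zero_forcing_number :: "'a set \<Rightarrow> 'a set set \<Rightarrow> nat" where
  "zero_forcing_number V E = (LEAST k. \<exists>B. zero_forcing_set V E B \<and> card B = k)"

text \<open>
  A drawing without crossings: vertices are distinct points of the plane, each edge is a simple
  arc between its end vertices that meets no other vertex, and two different edges
  meet only in common end vertices.  The plane is the type of complex numbers, for which the
  library states the Jordan curve theorem.
\<close>

definition plane_drawing ::
    "'a set \<Rightarrow> 'a set set \<Rightarrow> ('a \<Rightarrow> complex) \<Rightarrow> ('a set \<Rightarrow> real \<Rightarrow> complex) \<Rightarrow> bool" where
  "plane_drawing V E p \<gamma> \<longleftrightarrow>
     inj_on p V \<and>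
     (\<forall>e\<in>E. arc (\<gamma> e) \<and> {pathstart (\<gamma> e), pathfinish (\<gamma> e)} = p ` e \<and>
             path_image (\<gamma> e) \<inter> p ` V = p ` e) \<and>
     (\<forall>e\<in>E. \<forall>e'\<in>E. e \<noteq> e' \<longrightarrow> path_image (\<gamma> e) \<inter> path_image (\<gamma> e') = p ` (e \<inter> e'))"

definition planar :: "'a set \<Rightarrow> 'a set set \<Rightarrow> bool" where
  "planar V E \<longleftrightarrow> (\<exists>p \<gamma>. plane_drawing V E p \<gamma>)"

end

theory Submission
  imports Defs "HOL-Complex_Analysis.Winding_Numbers"
begin

text \<open>
  Let \<open>chi\<close>, \<open>\<omega>\<close> and \<open>Z\<close> be the chromatic, clique and zero forcing numbers of a planar graph.
  The bound is equivalent to \<open>2 * chi \<le> \<omega> + Z + 2\<close>, and since planar graphs are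
  5-colourable, only the values of \<open>chi\<close> up to 5 matter. The inequality follows from the
  following facts by going through these values:

  \<^item> \<open>chi \<le> 5\<close>;
  \<^item> \<open>chi \<le> Z + 1\<close>, and \<open>chi \<le> 4\<close> if \<open>Z = 4\<close>;
  \<^item> if the graph is triangle-free, then \<open>chi \<le> 3\<close> for \<open>Z \<le> 3\<close> and \<open>chi \<le> 4\<close> for \<open>Z \<le> 5\<close>;
  \<^item> \<open>\<omega> \<ge> 2\<close> if there is an edge.

  A zero forcing set of size \<open>Z\<close> sweeps the graph with a front of at most \<open>Z\<close> active vertices:
  when \<open>u\<close> forces \<open>v\<close>, the vertex \<open>v\<close> replaces \<open>u\<close> in the front. Each vertex is active during an
  interval of time, adjacent vertices have intersecting intervals, and at most \<open>Z + 1\<close> intervals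
  overlap (\<open>zero_forcing_interval_model\<close>). A vertex whose interval ends first has degree at
  most \<open>Z\<close>, which gives \<open>chi \<le> Z + 1\<close>. In a triangle-free graph the vertices are coloured in the order of
  the sweep. The neighbours of a new vertex in the front are independent, so it suffices to maintain
  that independent sets in the front do not use all colours; as long as the front is small compared
  with the number of colours, this invariant can be kept (\<open>colour_free_and_frugal\<close>).

  The other two facts use planarity, in the form that no contraction of a planar graph contains five
  pairwise adjacent vertices. In such a class of graphs a vertex of degree \<open>k \<ge> 4\<close> has two
  non-adjacent neighbours, which can be identified by contraction, so \<open>k\<close> colours suffice
  whenever all members of the class have a vertex of degree at most \<open>k\<close>
  (\<open>colourable_if_small_degrees\<close>). For \<open>Z = 4\<close> the interval model, which is inherited by
  contractions, provides a vertex of degree at most 4. In general the absence of the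
  minor bounds the number of edges by \<open>3 * n - 6\<close> (\<open>edge_bound\<close>) and provides a vertex of degree at most 5.

  To follow contractions in the plane, the vertices of a drawing are allowed to be path-connected sets
  (\<open>thick_drawing\<close>). Five such sets that are pairwise joined by arcs would contain a plane drawing of the complete
  graph on four vertices together with a further point that can be joined to each vertex
  without crossing the triangle of the other three. The Jordan curve theorem and the
  additivity of winding numbers exclude this (\<open>no_point_sees_all_vertices\<close>).
\<close>

section \<open>Arcs in path-connected sets\<close>

text \<open>
  Arcs are handled through their images, so that they can be reversed, cut and glued without
  naming parametrisations.
\<close>

definition arc_between :: "complex set \<Rightarrow> complex \<Rightarrow> complex \<Rightarrow> bool" where
  "arc_between A x y \<longleftrightarrow> (\<exists>g. arc g \<and> pathstart g = x \<and> pathfinish g = y \<and> path_image g = A)"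

text \<open>
  An arc that may shrink to a point. The legs of a tripod below can be trivial, and with
  links they need no separate treatment when arcs are glued.
\<close>

definition link :: "complex set \<Rightarrow> complex \<Rightarrow> complex \<Rightarrow> bool" where
  "link A x y \<longleftrightarrow> (x = y \<and> A = {x}) \<or> arc_between A x y"

lemma arc_between_sym: "arc_between A x y \<Longrightarrow> arc_between A y x"
  unfolding arc_between_def
  by (metis arc_reversepath path_image_reversepath pathfinish_reversepath pathstart_reversepath)

lemma arc_between_ends: "arc_between A x y \<Longrightarrow> x \<in> A \<and> y \<in> A \<and> x \<noteq> y"
  unfolding arc_between_def
  using arc_distinct_ends pathfinish_in_path_image pathstart_in_path_image by blast

lemma link_sym: "link A x y \<Longrightarrow> link A y x"
  using arc_between_sym by (auto simp: link_def)

lemma link_ends: "link A x y \<Longrightarrow> x \<in> A \<and> y \<in> A"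
  using arc_between_ends by (auto simp: link_def)

lemma link_closed: "link A x y \<Longrightarrow> closed A"
  by (auto simp: link_def arc_between_def intro: closed_path_image arc_imp_path)

lemma arc_between_link: "\<lbrakk>link A x y; x \<noteq> y\<rbrakk> \<Longrightarrow> arc_between A x y"
  by (auto simp: link_def)

lemma arc_between_path_connected: "arc_between A x y \<Longrightarrow> path_connected A"
  unfolding arc_between_def using arc_imp_path path_connected_path_image by blast

lemma link_join:
  assumes "link A x y" "link B y z" "A \<inter> B = {y}"
  shows "link (A \<union> B) x z"
proof -
  have "arc_between (A \<union> B) x z" if A: "arc_between A x y" and B: "arc_between B y z"
  proof -
    obtain g where g: "arc g" "pathstart g = x" "pathfinish g = y" "path_image g = A"
      using A by (auto simp: arc_between_def)
    obtain h where h: "arc h" "pathstart h = y" "pathfinish h = z" "path_image h = B"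
      using B by (auto simp: arc_between_def)
    have "arc (g +++ h)"
      using g h assms(3) by (intro arc_join) auto
    then show ?thesis
      unfolding arc_between_def using g h
      by (intro exI[of _ "g +++ h"]) (auto simp: path_image_join)
  qed
  moreover have "A \<union> B = B" if "A = {y}" using that link_ends[OF assms(2)] by blast
  moreover have "A \<union> B = A" if "B = {y}" using that link_ends[OF assms(1)] by blast
  ultimately show ?thesis using assms(1,2) unfolding link_def by metis
qed

lemma link_split:
  assumes "link A x y" "w \<in> A"
  shows "\<exists>B C. link B x w \<and> link C w y \<and> B \<inter> C = {w} \<and> B \<union> C = A"
proof (cases "arc_between A x y")
  case False
  then have "x = y" "A = {x}" "w = x" using assms by (auto simp: link_def)
  then show ?thesis by (intro exI[of _ "{x}"]) (auto simp: link_def)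
next
  case True
  then obtain g where g: "arc g" "pathstart g = x" "pathfinish g = y" "path_image g = A"
    by (auto simp: arc_between_def)
  then obtain t where t: "t \<in> {0..1}" "g t = w"
    using assms(2) by (auto simp: path_image_def)
  have inj: "inj_on g {0..1}" using g(1) by (simp add: arc_def)
  have sub: "link (g ` {a..b}) (g a) (g b)" if "0 \<le> a" "a \<le> b" "b \<le> 1" for a b
  proof (cases "a = b")
    case True then show ?thesis by (simp add: link_def)
  next
    case False
    then have "arc (subpath a b g)" using that g(1) by (intro arc_subpath_arc) auto
    then show ?thesis using that
      unfolding link_def arc_between_def
      by (intro disjI2 exI[of _ "subpath a b g"]) (auto simp: path_image_subpath)
  qed
  have "link (g ` {0..t}) x w" "link (g ` {t..1}) w y"
    using sub[of 0 t] sub[of t 1] t g by (auto simp: pathstart_def pathfinish_def)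
  moreover have "g ` {0..t} \<inter> g ` {t..1} = g ` ({0..t} \<inter> {t..1})"
    using inj t by (intro inj_on_image_Int[symmetric, where C = "{0..1}"]) auto
  moreover have "{0..t} \<inter> {t..1} = {t}" using t by auto
  moreover have "g ` {0..t} \<union> g ` {t..1} = A"
    using t g(4) unfolding path_image_def
    by (simp add: image_Un[symmetric] ivl_disj_un_two_touch(4))
  ultimately show ?thesis using t(2) by (metis image_empty image_insert)
qed

text \<open>
  Follow an arc from \<open>z\<close> until it meets the closed set for the first time.
\<close>

lemma link_to_closed_set:
  assumes "path_connected X" "z \<in> X" "closed A" "A \<subseteq> X" "A \<noteq> {}"
  shows "\<exists>w C. link C w z \<and> C \<subseteq> X \<and> C \<inter> A = {w}"
proof (cases "z \<in> A")
  case True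
  then show ?thesis using assms by (intro exI[of _ z] exI[of _ "{z}"]) (auto simp: link_def)
next
  case False
  obtain x where "x \<in> A" using assms by auto
  then obtain g where g: "arc g" "path_image g \<subseteq> X" "pathstart g = z" "pathfinish g = x"
    using assms False path_connected_arcwise by (metis subsetD)
  define T where "T = {0..1} \<inter> g -` A"
  have "continuous_on {0..1} g" using g(1) by (simp add: arc_def path_def)
  then have clT: "closed T"
    unfolding T_def using assms(3) by (simp add: continuous_on_closed_vimage Int_commute)
  have "1 \<in> T" using g \<open>x \<in> A\<close> by (auto simp: T_def pathfinish_def)
  have bT: "bdd_below T" by (auto simp: T_def intro: bdd_belowI[of _ 0])
  define t where "t = Inf T"
  have tT: "t \<in> T" unfolding t_def using closed_contains_Inf[OF _ bT clT] \<open>1 \<in> T\<close> by auto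
  have tmin: "t \<le> s" if "s \<in> T" for s
    unfolding t_def using bT that by (rule cInf_lower[rotated])
  have t01: "0 \<le> t" "t \<le> 1" "g t \<in> A" using tT by (auto simp: T_def)
  have "t \<noteq> 0" using t01(3) False g(3) by (auto simp: pathstart_def)
  have "arc (subpath 0 t g)" using g(1) t01 \<open>t \<noteq> 0\<close> by (intro arc_subpath_arc) auto
  then have "link (g ` {0..t}) z (g t)"
    unfolding link_def arc_between_def using t01 g(3)
    by (intro disjI2 exI[of _ "subpath 0 t g"]) (auto simp: path_image_subpath pathstart_def[of g])
  moreover have "g ` {0..t} \<subseteq> X" using g(2) t01 by (auto simp: path_image_def)
  moreover have "g ` {0..t} \<inter> A = {g t}"
  proof -
    have "s = t" if "s \<in> {0..t}" "g s \<in> A" for s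
      using that tmin[of s] t01 by (auto simp: T_def)
    then show ?thesis using t01 by fastforce
  qed
  ultimately show ?thesis using link_sym by blast
qed

text \<open>
  Join \<open>x\<close> to \<open>y\<close> by an arc, and \<open>z\<close> to the first
  point \<open>w\<close> of that arc: the arc is cut at \<open>w\<close> into two legs.
\<close>

lemma tripod:
  assumes X: "path_connected X" and "x \<in> X" "y \<in> X" "z \<in> X"
  shows "\<exists>w A B C. link A w x \<and> link B w y \<and> link C w z \<and> A \<union> B \<union> C \<subseteq> X
    \<and> A \<inter> B = {w} \<and> A \<inter> C = {w} \<and> B \<inter> C = {w}"
proof -
  have "\<exists>P. link P x y \<and> P \<subseteq> X"
  proof (cases "x = y")
    case True then show ?thesis using assms by (intro exI[of _ "{x}"]) (auto simp: link_def)
  next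
    case False then show ?thesis
      using assms unfolding path_connected_arcwise link_def arc_between_def by metis
  qed
  then obtain P where P: "link P x y" "P \<subseteq> X" by blast
  obtain w C where C: "link C w z" "C \<subseteq> X" "C \<inter> P = {w}"
    using link_to_closed_set[OF X \<open>z \<in> X\<close> link_closed[OF P(1)] P(2)] link_ends[OF P(1)] by blast
  then obtain A B where AB: "link A x w" "link B w y" "A \<inter> B = {w}" "A \<union> B = P"
    using link_split[OF P(1), of w] by blast
  have "w \<in> A" "w \<in> B" "w \<in> C" using AB C by auto
  then have "A \<inter> C = {w}" "B \<inter> C = {w}" using AB(4) C(3) by auto
  then show ?thesis using AB C P link_sym[OF AB(1)] by (intro exI[of _ w] exI[of _ A] exI[of _ B] exI[of _ C]) auto
qed

text \<open>
  The inside of a set is a union of components of its complement. This is how two points are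
  shown to lie on the same side of a closed curve.
\<close>

lemma connected_subset_inside:
  assumes "connected K" "K \<inter> S = {}" "x \<in> K" "x \<in> inside S"
  shows "K \<subseteq> inside S"
proof
  fix y assume "y \<in> K"
  then have "connected_component (- S) x y"
    using assms unfolding connected_component_def by (intro exI[of _ K]) auto
  then show "y \<in> inside S" using assms(4) inside_same_component by blast
qed

lemma connected_unbounded_subset_outside:
  assumes "connected K" "K \<inter> S = {}" "\<not> bounded K"
  shows "K \<subseteq> outside S"
proof
  fix y assume y: "y \<in> K"
  then have "K \<subseteq> connected_component_set (- S) y"
    using assms by (intro connected_component_maximal) auto
  then show "y \<in> outside S"
    using y assms bounded_subset by (auto simp: outside)
qed

section \<open>Plane drawings of the complete graph on four vertices\<close>

text \<open>
  The vertices are the numbers below 4, and \<open>e i j\<close> is the image of the arc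
  that joins \<open>p i\<close> to \<open>p j\<close>. For every choice of three vertices
  the three arcs between them form a simple closed curve, to which the Jordan curve theorem
  applies.
\<close>

locale plane_K4 =
  fixes p :: "nat \<Rightarrow> complex" and e :: "nat \<Rightarrow> nat \<Rightarrow> complex set"
  assumes edge: "\<lbrakk>i < 4; j < 4; i \<noteq> j\<rbrakk> \<Longrightarrow> arc_between (e i j) (p i) (p j)"
    and edge_sym: "\<lbrakk>i < 4; j < 4; i \<noteq> j\<rbrakk> \<Longrightarrow> e i j = e j i"
    and adjacent_edges: "\<lbrakk>i < 4; j < 4; k < 4; distinct [i, j, k]\<rbrakk> \<Longrightarrow> e i j \<inter> e i k = {p i}"
    and opposite_edges:
      "\<lbrakk>i < 4; j < 4; k < 4; l < 4; distinct [i, j, k, l]\<rbrakk> \<Longrightarrow> e i j \<inter> e k l = {}"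
begin

definition triangle :: "nat \<Rightarrow> nat \<Rightarrow> nat \<Rightarrow> complex set" where
  "triangle i j k = e i j \<union> e j k \<union> e i k"

lemma triangle_rotate:
  assumes "i < 4" "j < 4" "k < 4" "distinct [i, j, k]"
  shows "triangle i j k = triangle j k i" "triangle i j k = triangle j i k"
  using assms edge_sym[of i j] edge_sym[of j k] edge_sym[of i k] by (auto simp: triangle_def)

lemma vertex_in_edge: "\<lbrakk>i < 4; j < 4; i \<noteq> j\<rbrakk> \<Longrightarrow> p i \<in> e i j \<and> p j \<in> e i j"
  using edge arc_between_ends by blast

lemma edge_meets_triangle:
  assumes "i < 4" "j < 4" "k < 4" "l < 4" "distinct [i, j, k, l]"
  shows "e l i \<inter> triangle i j k = {p i}"
proof -
  have "e l i \<inter> e i j = {p i}" "e l i \<inter> e i k = {p i}" "e l i \<inter> e j k = {}"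
    using adjacent_edges[of i l j] adjacent_edges[of i l k] opposite_edges[of l i j k] assms
      edge_sym[of l i] by auto
  then show ?thesis by (auto simp: triangle_def)
qed

lemma vertex_not_in_triangle:
  assumes "i < 4" "j < 4" "k < 4" "l < 4" "distinct [i, j, k, l]"
  shows "p l \<notin> triangle i j k"
  using edge_meets_triangle[OF assms] vertex_in_edge[of l i] edge[of l i] arc_between_ends assms
  by auto

lemma connected_half_edge:
  assumes "i < 4" "l < 4" "i \<noteq> l"
  shows "connected (e l i - {p i})"
proof -
  obtain g where g: "arc g" "pathstart g = p l" "pathfinish g = p i" "path_image g = e l i"
    using edge[of l i] assms by (auto simp: arc_between_def)
  have inj: "inj_on g {0..1}" using g(1) by (simp add: arc_def)
  have "g ` {0..<1} = g ` ({0..1} - {1})" by (intro arg_cong[where f = "\<lambda>S. g ` S"]) auto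
  also have "\<dots> = g ` {0..1} - g ` {1}"
    using inj by (intro inj_on_image_set_diff[where C = "{0..1}"]) auto
  finally have "g ` {0..<1} = e l i - {p i}" using g by (auto simp: path_image_def pathfinish_def)
  moreover have "connected (g ` {0..<1})"
    using g(1) by (intro connected_continuous_image)
      (auto simp: arc_def path_def intro: continuous_on_subset)
  ultimately show ?thesis by simp
qed

text \<open>
  An edge from \<open>p l\<close> meets the triangle on the other three vertices only in its
  far end, so it stays on the side of \<open>p l\<close>.
\<close>

lemma half_edge_side:
  assumes "i < 4" "j < 4" "k < 4" "l < 4" "distinct [i, j, k, l]" "z \<in> e l i - {p i}"
  shows "z \<in> inside (triangle i j k) \<longleftrightarrow> p l \<in> inside (triangle i j k)"
proof -
  have c: "connected (e l i - {p i})" using connected_half_edge assms by auto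
  have d: "(e l i - {p i}) \<inter> triangle i j k = {}" using edge_meets_triangle[OF assms(1-5)] by blast
  have "p l \<in> e l i - {p i}"
    using edge[of l i] arc_between_ends assms by auto
  then show ?thesis using connected_subset_inside[OF c d] assms(6) by blast
qed

text \<open>
  One parametrisation of each edge is fixed, so that the winding numbers of the four
  triangles are expressed by the same six numbers and can cancel.
\<close>

definition edge_path :: "nat \<Rightarrow> nat \<Rightarrow> real \<Rightarrow> complex" where
  "edge_path i j =
    (SOME g. arc g \<and> pathstart g = p i \<and> pathfinish g = p j \<and> path_image g = e i j)"

lemma edge_path:
  assumes "i < 4" "j < 4" "i \<noteq> j"
  shows "arc (edge_path i j)" "pathstart (edge_path i j) = p i"
    "pathfinish (edge_path i j) = p j" "path_image (edge_path i j) = e i j"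
  using someI_ex[OF edge[OF assms, unfolded arc_between_def]] by (auto simp: edge_path_def)

definition triangle_path :: "nat \<Rightarrow> nat \<Rightarrow> nat \<Rightarrow> real \<Rightarrow> complex" where
  "triangle_path i j k = (edge_path i j +++ edge_path j k) +++ reversepath (edge_path i k)"

lemma triangle_path:
  assumes "i < 4" "j < 4" "k < 4" "distinct [i, j, k]"
  shows "simple_path (triangle_path i j k)"
    "pathfinish (triangle_path i j k) = pathstart (triangle_path i j k)"
    "path_image (triangle_path i j k) = triangle i j k"
proof -
  have d: "i \<noteq> j" "j \<noteq> k" "i \<noteq> k" using assms by auto
  note e = edge_path[OF assms(1,2) d(1)] edge_path[OF assms(2,3) d(2)] edge_path[OF assms(1,3) d(3)]
  have int: "e i j \<inter> e j k = {p j}" "e i j \<inter> e i k = {p i}" "e j k \<inter> e i k = {p k}"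
    using adjacent_edges[of j i k] adjacent_edges[of i j k] adjacent_edges[of k j i] assms edge_sym
    by auto
  have a: "arc (edge_path i j +++ edge_path j k)"
    using e int by (intro arc_join) auto
  show "path_image (triangle_path i j k) = triangle i j k"
    using e by (simp add: triangle_path_def triangle_def path_image_join)
  show "simple_path (triangle_path i j k)"
    unfolding triangle_path_def
    using a e int by (intro simple_path_join_loop) (auto simp: path_image_join arc_reversepath)
  show "pathfinish (triangle_path i j k) = pathstart (triangle_path i j k)"
    using e by (simp add: triangle_path_def)
qed

lemma triangle_jordan:
  assumes "i < 4" "j < 4" "k < 4" "distinct [i, j, k]"
  defines "T \<equiv> triangle i j k"
  shows "inside T \<noteq> {}" "open (inside T)" "connected (inside T)" "connected (outside T)"
    "\<not> bounded (outside T)" "frontier (inside T) = T" "frontier (outside T) = T"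
  using Jordan_inside_outside[OF triangle_path(1,2), OF assms(1-4) assms(1-4)]
  unfolding triangle_path(3)[OF assms(1-4)] T_def[symmetric] by auto

text \<open>
  If \<open>p l\<close> lies inside the triangle \<open>i j k\<close>, then so does the
  whole triangle \<open>i j l\<close> apart from the edge \<open>i j\<close>. Hence the
  outside of the first triangle is contained in the outside of the second. The vertex
  \<open>p k\<close> is a boundary point of the former and so cannot be an interior point of
  the inside of the latter.
\<close>

lemma only_one_vertex_inside:
  assumes l: "i < 4" "j < 4" "k < 4" "l < 4" "distinct [i, j, k, l]"
    and "p l \<in> inside (triangle i j k)"
  shows "p k \<notin> inside (triangle i j l)"
proof
  assume k: "p k \<in> inside (triangle i j l)"
  let ?T = "triangle i j k"
  have ij: "e l i - {p i} \<subseteq> inside ?T"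
    using half_edge_side[of i j k l] assms by auto
  have "e l j - {p j} \<subseteq> inside ?T"
    using half_edge_side[of j k i l] triangle_rotate[of i j k] assms by auto
  with ij have "triangle i j l \<subseteq> ?T \<union> inside ?T"
    using l edge_sym[of l i] edge_sym[of l j] vertex_in_edge[of i j]
    by (auto simp: triangle_def)
  \<comment> \<open>The triangle \<open>i j l\<close> lies in the closed region bounded by \<open>?T\<close>.\<close>
  then have disj: "outside ?T \<inter> triangle i j l = {}"
    using outside_no_overlap inside_Int_outside by blast
  have J: "connected (outside ?T)" "\<not> bounded (outside ?T)" "frontier (outside ?T) = ?T"
    using triangle_jordan[of i j k] l by auto
  have out: "outside ?T \<subseteq> outside (triangle i j l)"
    by (rule connected_unbounded_subset_outside[OF J(1) disj J(2)])
  have "p k \<in> ?T" using vertex_in_edge[of j k] l by (auto simp: triangle_def)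
  then have "p k \<in> closure (outside ?T)" using J(3) by (auto simp: frontier_def)
  moreover have "open (inside (triangle i j l))" using triangle_jordan(2)[of i j l] l by auto
  ultimately have "inside (triangle i j l) \<inter> outside ?T \<noteq> {}"
    using k open_Int_closure_eq_empty by blast
  then show False using out inside_Int_outside by blast
qed

lemma inside_avoids_other_edges:
  assumes l: "i < 4" "j < 4" "k < 4" "l < 4" "distinct [i, j, k, l]"
    and out: "p l \<notin> inside (triangle i j k)"
  shows "inside (triangle i j k) \<inter> (triangle i j k \<union> e l i) = {}"
proof -
  have "e l i - {p i} \<subseteq> - inside (triangle i j k)"
    using half_edge_side[OF l] out by auto
  moreover have "p i \<in> triangle i j k"
    using vertex_in_edge[of i j] l by (auto simp: triangle_def)
  moreover have "inside (triangle i j k) \<inter> triangle i j k = {}" by (rule inside_no_overlap)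
  ultimately show ?thesis by blast
qed

lemma inside_subset_inside:
  assumes l: "i < 4" "j < 4" "k < 4" "l < 4" "distinct [i, j, k, l]"
    and out: "p l \<notin> inside (triangle i j k)"
    and ne: "inside (triangle i j k) \<inter> inside (triangle i j l) \<noteq> {}"
  shows "inside (triangle i j k) \<subseteq> inside (triangle i j l)"
proof -
  have "inside (triangle i j k) \<inter> (triangle i j k \<union> e l i) = {}"
    by (rule inside_avoids_other_edges[OF l out])
  moreover have "inside (triangle i j k) \<inter> (triangle i j k \<union> e l j) = {}"
    using inside_avoids_other_edges[of j i k l] triangle_rotate[of i j k] l out by auto
  ultimately have "inside (triangle i j k) \<inter> triangle i j l = {}"
    using l edge_sym[of l i] edge_sym[of l j] unfolding triangle_def by blast
  moreover have "connected (inside (triangle i j k))" using triangle_jordan(3)[of i j k] l by auto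
  ultimately show ?thesis using connected_subset_inside ne by blast
qed

text \<open>
  If neither triangle has the remaining vertex inside, then no edge enters either of the two
  insides. Overlapping insides would therefore be equal, and so would their frontiers, which
  are the triangles themselves.
\<close>

lemma empty_triangles_disjoint:
  assumes l: "i < 4" "j < 4" "k < 4" "l < 4" "distinct [i, j, k, l]"
    and "p l \<notin> inside (triangle i j k)" "p k \<notin> inside (triangle i j l)"
  shows "inside (triangle i j k) \<inter> inside (triangle i j l) = {}"
proof (rule ccontr)
  assume ne: "inside (triangle i j k) \<inter> inside (triangle i j l) \<noteq> {}"
  have "inside (triangle i j k) \<subseteq> inside (triangle i j l)"
    using inside_subset_inside[OF l] assms(6) ne by blast
  moreover have "inside (triangle i j l) \<subseteq> inside (triangle i j k)"
    using inside_subset_inside[of i j l k] l assms(7) ne by (simp add: Int_commute)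
  ultimately have eq: "inside (triangle i j k) = inside (triangle i j l)" by (rule equalityI)
  have "frontier (inside (triangle i j k)) = triangle i j k"
    "frontier (inside (triangle i j l)) = triangle i j l"
    by (rule triangle_jordan(6); use l in auto)+
  then have "triangle i j k = triangle i j l" unfolding eq by (rule trans[OF sym])
  moreover have "p l \<in> triangle i j l"
    using vertex_in_edge[of j l] l by (simp add: triangle_def)
  ultimately show False
    using vertex_not_in_triangle[OF l] by simp
qed

lemma winding_triangle:
  assumes "i < 4" "j < 4" "k < 4" "distinct [i, j, k]" "z \<notin> triangle i j k"
  shows "winding_number (triangle_path i j k) z
    = winding_number (edge_path i j) z + winding_number (edge_path j k) z
      - winding_number (edge_path i k) z"
proof -
  have d: "i \<noteq> j" "j \<noteq> k" "i \<noteq> k" using assms by auto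
  note e = edge_path[OF assms(1,2) d(1)] edge_path[OF assms(2,3) d(2)] edge_path[OF assms(1,3) d(3)]
  show ?thesis
    unfolding triangle_path_def using e assms(5)
    by (simp add: winding_number_join winding_number_reversepath arc_imp_path triangle_def
        path_image_join)
qed

lemma winding_triangle_eq_0_iff:
  assumes "i < 4" "j < 4" "k < 4" "distinct [i, j, k]" "z \<notin> triangle i j k"
  shows "winding_number (triangle_path i j k) z = 0 \<longleftrightarrow> z \<notin> inside (triangle i j k)"
proof -
  note T = triangle_path[OF assms(1-4)]
  have "z \<in> outside (triangle i j k)" if "z \<notin> inside (triangle i j k)"
    using that assms(5) inside_Un_outside by blast
  then have "winding_number (triangle_path i j k) z = 0" if "z \<notin> inside (triangle i j k)"
    using that winding_number_zero_in_outside[of "triangle_path i j k" z] T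
    by (simp add: simple_path_imp_path)
  moreover have "winding_number (triangle_path i j k) z \<noteq> 0" if "z \<in> inside (triangle i j k)"
    using simple_closed_path_winding_number_inside[OF T(1)] that T(3)
    by (metis one_neq_zero neg_equal_0_iff_equal)
  ultimately show ?thesis by blast
qed

text \<open>
  The triangle opposite to the vertex \<open>l\<close>, in a form that does not depend on an
  order of the other vertices.
\<close>

definition face :: "nat \<Rightarrow> complex set" where
  "face l = (\<Union>i\<in>{..<4} - {l}. \<Union>j\<in>{..<4} - {l, i}. e i j)"

lemma face_eq:
  assumes "i < 4" "j < 4" "k < 4" "l < 4" "distinct [i, j, k, l]"
  shows "face l = triangle i j k"
proof -
  have "{..<4} - {l} = {i, j, k}" 
    using assms by (auto simp: numeral_eq_Suc less_Suc_eq)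
  moreover have "{..<4} - {l, i} = {j, k}" "{..<4} - {l, j} = {i, k}" "{..<4} - {l, k} = {i, j}"
    using assms by (auto simp: numeral_eq_Suc less_Suc_eq)
  ultimately show ?thesis
    using assms edge_sym[of i j] edge_sym[of j k] edge_sym[of i k]
    by (auto simp: face_def triangle_def)
qed

lemma other_indices:
  fixes l m :: nat
  assumes "l < 4" "m < 4" "l \<noteq> m"
  obtains i j where "i < 4" "j < 4" "distinct [i, j, m, l]"
proof -
  have "card ({..<4} - {l, m}) = 2" using assms by (simp add: card_Diff_subset)
  then obtain i j where ij: "{..<4} - {l, m} = {i, j}" "i \<noteq> j" by (auto simp: card_2_iff)
  then have "i \<in> {..<4} - {l, m}" "j \<in> {..<4} - {l, m}" by auto
  then show thesis using that[of i j] ij assms by auto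
qed

text \<open>
  The alternating sum of the winding numbers of the four triangles about \<open>z\<close>
  vanishes, because each edge is traversed once in each direction. A winding number is
  nonzero exactly inside the triangle, so it is impossible that exactly one of the four is
  nonzero.
\<close>

lemma inside_another_face:
  assumes z: "\<And>m. m < 4 \<Longrightarrow> z \<notin> face m" and l: "l < 4" "z \<in> inside (face l)"
  shows "\<exists>m<4. m \<noteq> l \<and> z \<in> inside (face m)"
proof (rule ccontr)
  assume none: "\<not> ?thesis"
  have f: "face 0 = triangle 1 2 3" "face 1 = triangle 0 2 3"
     "face 2 = triangle 0 1 3" "face 3 = triangle 0 1 2"
    by (rule face_eq; simp)+
  have zf: "z \<notin> triangle 1 2 3" "z \<notin> triangle 0 2 3" "z \<notin> triangle 0 1 3" "z \<notin> triangle 0 1 2"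
    using z[of 0] z[of 1] z[of 2] z[of 3] f by auto
  have "winding_number (triangle_path 0 1 2) z - winding_number (triangle_path 0 1 3) z
    + winding_number (triangle_path 0 2 3) z - winding_number (triangle_path 1 2 3) z = 0"
    using zf by (simp add: winding_triangle)
  moreover have "winding_number (triangle_path 0 1 2) z = 0 \<longleftrightarrow> z \<notin> inside (face 3)"
    "winding_number (triangle_path 0 1 3) z = 0 \<longleftrightarrow> z \<notin> inside (face 2)"
    "winding_number (triangle_path 0 2 3) z = 0 \<longleftrightarrow> z \<notin> inside (face 1)"
    "winding_number (triangle_path 1 2 3) z = 0 \<longleftrightarrow> z \<notin> inside (face 0)"
    unfolding f using zf by (simp_all add: winding_triangle_eq_0_iff)
  moreover have "l \<in> {0, 1, 2, 3}" using l(1) by auto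
  moreover have "m = l \<or> z \<notin> inside (face m)" if "m < 4" for m
    using none that by auto
  note this[of 0] this[of 1] this[of 2] this[of 3]
  ultimately show False using l(2) by auto
qed

lemma face_pair:
  assumes "l < 4" "m < 4" "l \<noteq> m"
  obtains i j where "i < 4" "j < 4" "distinct [i, j, m, l]"
    "face l = triangle i j m" "face m = triangle i j l"
proof -
  obtain i j where "i < 4" "j < 4" "distinct [i, j, m, l]"
    using other_indices[OF assms] .
  then show thesis using that[of i j] face_eq[of i j m l] face_eq[of i j l m] assms by auto
qed

text \<open>
  This is what makes five mutually joined sets impossible in the plane: a fifth set would
  supply a point \<open>z\<close> as assumed here. If some vertex lies inside its opposite
  triangle, then this happens for one vertex only, so \<open>z\<close> is inside exactly one
  triangle, against the cancellation of winding numbers. If no vertex does, then the four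
  insides are pairwise disjoint and avoid all edges, and any point of the inside of one
  triangle contradicts the cancellation in the same way.
\<close>

theorem no_point_sees_all_vertices:
  assumes z: "\<And>m. m < 4 \<Longrightarrow> z \<notin> face m"
    and same: "\<And>m. m < 4 \<Longrightarrow> z \<in> inside (face m) \<longleftrightarrow> p m \<in> inside (face m)"
  shows False
proof (cases "\<exists>l<4. p l \<in> inside (face l)")
  case True
  then obtain l where l: "l < 4" "p l \<in> inside (face l)" by auto
  then obtain m where m: "m < 4" "m \<noteq> l" "p m \<in> inside (face m)"
    using inside_another_face[of z l] z same by auto
  obtain i j where "i < 4" "j < 4" "distinct [i, j, m, l]"
    "face l = triangle i j m" "face m = triangle i j l"
    using face_pair[of l m] l(1) m(1,2) by metis
  then show False
    using only_one_vertex_inside[of i j m l] l m by auto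
next
  case False
  obtain y where y: "y \<in> inside (face 0)"
    using triangle_jordan(1)[of 1 2 3] face_eq[of 1 2 3 0] by auto
  have disj: "inside (face 0) \<inter> inside (face m) = {}" "inside (face 0) \<inter> face m = {}"
    if m: "m < 4" "0 \<noteq> m" for m
  proof -
    obtain i j where ij: "i < 4" "j < 4" "distinct [i, j, m, 0]"
      and f: "face 0 = triangle i j m" "face m = triangle i j 0"
      using face_pair[of 0 m] m by (metis zero_less_numeral)
    have out: "p 0 \<notin> inside (triangle i j m)" "p m \<notin> inside (triangle i j 0)"
      using False m unfolding f[symmetric] by auto
    show "inside (face 0) \<inter> inside (face m) = {}"
      unfolding f using empty_triangles_disjoint[of i j m 0] ij m out by auto
    have swap: "triangle j i m = triangle i j m"
      using triangle_rotate(2)[of j i m] ij m by simp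
    have "inside (triangle i j m) \<inter> (triangle i j m \<union> e 0 i) = {}"
      using inside_avoids_other_edges[of i j m 0] ij m out by simp
    moreover have "inside (triangle i j m) \<inter> (triangle i j m \<union> e 0 j) = {}"
      using inside_avoids_other_edges[of j i m 0] ij m out unfolding swap by simp
    moreover have "triangle i j 0 \<subseteq> triangle i j m \<union> e 0 i \<union> e 0 j"
      using edge_sym[of 0 i] edge_sym[of 0 j] ij by (auto simp: triangle_def)
    ultimately show "inside (face 0) \<inter> face m = {}"
      unfolding f by blast
  qed
  have "y \<notin> face m" if m: "m < 4" for m
    using y disj(2)[OF m] inside_no_overlap[of "face 0"] by (cases "m = 0") blast+
  then obtain m where "m < 4" "m \<noteq> 0" "y \<in> inside (face m)"
    using inside_another_face[of y 0] y by (metis zero_less_numeral)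
  then show False using y disj(1)[of m] by blast
qed

end

section \<open>Degrees, colourings and edge contraction\<close>

definition nbrs :: "'a set set \<Rightarrow> 'a \<Rightarrow> 'a set" where
  "nbrs E v = {u. {u, v} \<in> E}"

lemma edge_ne: "finite_simple_graph V E \<Longrightarrow> {u, v} \<in> E \<Longrightarrow> u \<noteq> v"
  by (fastforce simp: finite_simple_graph_def)

lemma nbrs_subset: "finite_simple_graph V E \<Longrightarrow> nbrs E v \<subseteq> V - {v}"
  using edge_ne by (fastforce simp: finite_simple_graph_def nbrs_def)

lemma nbrs_finite: "finite_simple_graph V E \<Longrightarrow> finite (nbrs E v)"
  by (meson finite_Diff finite_simple_graph_def finite_subset nbrs_subset)

lemma finite_edges: "finite_simple_graph V E \<Longrightarrow> finite E"
  by (rule finite_subset[of _ "Pow V"]) (auto simp: finite_simple_graph_def)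

lemma edge_doubleton:
  assumes "finite_simple_graph V E" "e \<in> E"
  shows "\<exists>u v. e = {u, v} \<and> u \<noteq> v"
  using assms unfolding finite_simple_graph_def card_2_iff by blast

definition edges_avoiding :: "'a \<Rightarrow> 'a set set \<Rightarrow> 'a set set" where
  "edges_avoiding v E = {e \<in> E. v \<notin> e}"

lemma card_edges_at:
  assumes "finite_simple_graph V E"
  shows "card {e \<in> E. v \<in> e} = card (nbrs E v)"
proof -
  have "bij_betw (\<lambda>u. {u, v}) (nbrs E v) {e \<in> E. v \<in> e}"
  proof (rule bij_betwI')
    fix x y assume "x \<in> nbrs E v" "y \<in> nbrs E v"
    then show "({x, v} = {y, v}) = (x = y)" by (auto simp: doubleton_eq_iff)
  next
    fix x assume "x \<in> nbrs E v" then show "{x, v} \<in> {e \<in> E. v \<in> e}" by (auto simp: nbrs_def)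
  next
    fix e assume e: "e \<in> {e \<in> E. v \<in> e}"
    then obtain a b where "e = {a, b}" using edge_doubleton[OF assms] by blast
    then show "\<exists>x\<in>nbrs E v. e = {x, v}" using e by (auto simp: nbrs_def insert_commute)
  qed
  then show ?thesis by (simp add: bij_betw_same_card)
qed

lemma card_edges_avoiding:
  assumes "finite_simple_graph V E"
  shows "card (edges_avoiding v E) + card (nbrs E v) = card E"
proof -
  have "E = edges_avoiding v E \<union> {e \<in> E. v \<in> e}" "edges_avoiding v E \<inter> {e \<in> E. v \<in> e} = {}"
    by (auto simp: edges_avoiding_def)
  then show ?thesis
    using card_Un_disjoint[of "edges_avoiding v E" "{e \<in> E. v \<in> e}"] finite_edges[OF assms]
      card_edges_at[OF assms, of v] by (metis finite_Un)
qed

lemma handshake: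
  assumes G: "finite_simple_graph V E"
  shows "(\<Sum>v\<in>V. card (nbrs E v)) = 2 * card E"
proof -
  have fin: "finite V" "finite E" using G finite_edges by (auto simp: finite_simple_graph_def)
  have "(\<Sum>v\<in>V. card (nbrs E v)) = (\<Sum>v\<in>V. card {e \<in> E. v \<in> e})"
    using card_edges_at[OF G] by simp
  also have "\<dots> = (\<Sum>v\<in>V. \<Sum>e\<in>E. if v \<in> e then 1 else 0)"
    using fin by (simp add: sum.If_cases Int_def)
  also have "\<dots> = (\<Sum>e\<in>E. \<Sum>v\<in>V. if v \<in> e then 1 else 0)" by (rule sum.swap)
  also have "\<dots> = (\<Sum>e\<in>E. 2)"
  proof (rule sum.cong)
    fix e assume "e \<in> E"
    then have "V \<inter> {v. v \<in> e} = e" "card e = 2" using G by (auto simp: finite_simple_graph_def)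
    then show "(\<Sum>v\<in>V. if v \<in> e then 1 else 0) = (2::nat)" using fin by (simp add: sum.If_cases)
  qed simp
  finally show ?thesis by simp
qed

definition merge :: "'a \<Rightarrow> 'a \<Rightarrow> 'a \<Rightarrow> 'a" where
  "merge a b x = (if x = b then a else x)"

text \<open>
  The edge between \<open>a\<close> and \<open>b\<close> is contracted to \<open>a\<close>.
  Edges that become loops no longer have two elements and disappear, and parallel edges are
  identified because edges are sets.
\<close>

definition contract :: "'a \<Rightarrow> 'a \<Rightarrow> 'a set set \<Rightarrow> 'a set set" where
  "contract a b E = {e'. card e' = 2 \<and> (\<exists>e\<in>E. e' = merge a b ` e)}"

lemma finite_simple_graph_contract:
  assumes "finite_simple_graph V E" "a \<in> V" "a \<noteq> b"
  shows "finite_simple_graph (V - {b}) (contract a b E)"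
  using assms by (fastforce simp: finite_simple_graph_def contract_def merge_def)

lemma contract_edge:
  "{x, y} \<in> E \<Longrightarrow> merge a b x \<noteq> merge a b y \<Longrightarrow> {merge a b x, merge a b y} \<in> contract a b E"
  unfolding contract_def by (auto intro!: bexI[of _ "{x, y}"])

lemma contract_unmerged_edge:
  "{x, y} \<in> E \<Longrightarrow> x \<noteq> y \<Longrightarrow> x \<noteq> b \<Longrightarrow> y \<noteq> b \<Longrightarrow> {x, y} \<in> contract a b E"
  using contract_edge[of x y E a b] by (simp add: merge_def)

lemma contract_merged_edge:
  "{x, b} \<in> E \<Longrightarrow> x \<noteq> a \<Longrightarrow> x \<noteq> b \<Longrightarrow> {x, a} \<in> contract a b E"
  using contract_edge[of x b E a b] by (simp add: merge_def)

text \<open>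
  Contracting an edge destroys that edge and, for each common neighbour of its ends, merges
  two edges into one.
\<close>

lemma card_contract:
  assumes G: "finite_simple_graph V E" and ab: "{a, b} \<in> E"
  shows "card E \<le> card (contract a b E) + 1 + card (nbrs E a \<inter> nbrs E b)"
proof -
  have ne: "a \<noteq> b" using edge_ne[OF G ab] .
  define S where "S = nbrs E b - nbrs E a - {a}"
  have fin: "finite S" "finite (nbrs E b)" "finite E"
    using nbrs_finite[OF G] finite_edges[OF G] by (auto simp: S_def)
  have Sne: "u \<noteq> a" "u \<noteq> b" "{u, b} \<in> E" "{u, a} \<notin> E" if "u \<in> S" for u
    using that edge_ne[OF G] by (auto simp: S_def nbrs_def)
  have "card (nbrs E b) \<le> card (S \<union> {a} \<union> (nbrs E a \<inter> nbrs E b))"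
    using fin by (intro card_mono) (auto simp: S_def)
  also have "\<dots> \<le> card (S \<union> {a}) + card (nbrs E a \<inter> nbrs E b)" by (rule card_Un_le)
  also have "card (S \<union> {a}) \<le> card S + 1"
    by (metis card_Un_le card.empty card.insert empty_iff finite.emptyI One_nat_def)
  finally have 1: "card (nbrs E b) \<le> card S + 1 + card (nbrs E a \<inter> nbrs E b)" by simp
  have "inj_on (\<lambda>u. {u, a}) S" by (auto simp: inj_on_def doubleton_eq_iff)
  then have 2: "card ((\<lambda>u. {u, a}) ` S) = card S" by (rule card_image)
  have 3: "edges_avoiding b E \<inter> (\<lambda>u. {u, a}) ` S = {}"
    using Sne by (auto simp: edges_avoiding_def)
  have "edges_avoiding b E \<subseteq> contract a b E"
  proof
    fix e assume e: "e \<in> edges_avoiding b E"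
    then have eE: "e \<in> E" "b \<notin> e" by (auto simp: edges_avoiding_def)
    obtain u v where "e = {u, v}" "u \<noteq> v" using edge_doubleton[OF G eE(1)] by blast
    then show "e \<in> contract a b E" using eE contract_unmerged_edge[of u v E b a] by auto
  qed
  moreover have "(\<lambda>u. {u, a}) ` S \<subseteq> contract a b E"
  proof
    fix e assume "e \<in> (\<lambda>u. {u, a}) ` S"
    then obtain u where u: "u \<in> S" "e = {u, a}" by blast
    then show "e \<in> contract a b E"
      using contract_merged_edge[OF Sne(3) Sne(1,2)] by simp
  qed
  moreover have "finite (contract a b E)"
    by (rule finite_subset[of _ "(`) (merge a b) ` E"]) (use fin in \<open>auto simp: contract_def\<close>)
  ultimately have "card (edges_avoiding b E \<union> (\<lambda>u. {u, a}) ` S) \<le> card (contract a b E)"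
    by (intro card_mono) auto
  then have "card (edges_avoiding b E) + card S \<le> card (contract a b E)"
    using card_Un_disjoint[OF _ _ 3] fin 2 by (simp add: edges_avoiding_def)
  then show ?thesis using 1 card_edges_avoiding[OF G, of b] by linarith
qed

text \<open>
  A vertex whose neighbours use fewer than \<open>k\<close> colours can be coloured last.
\<close>

lemma extend_colouring:
  assumes G: "finite_simple_graph V E"
    and c: "proper_colouring (V - {v}) (edges_avoiding v E) k c" and free: "card (c ` nbrs E v) < k"
  shows "\<exists>c. proper_colouring V E k c"
proof -
  have "\<not> {..<k} \<subseteq> c ` nbrs E v"
    using free card_mono[of "c ` nbrs E v" "{..<k}"] nbrs_finite[OF G] by fastforce
  then obtain x where x: "x < k" "x \<notin> c ` nbrs E v" by auto
  have "proper_colouring V E k (c(v := x))"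
    unfolding proper_colouring_def
  proof (intro conjI ballI impI)
    fix w assume "w \<in> V" then show "(c(v := x)) w < k" using c x by (auto simp: proper_colouring_def)
  next
    fix u w assume uw: "u \<in> V" "w \<in> V" "{u, w} \<in> E"
    have "u \<noteq> w" using edge_ne[OF G uw(3)] .
    consider "u = v" "w \<noteq> v" | "w = v" "u \<noteq> v" | "u \<noteq> v" "w \<noteq> v" using \<open>u \<noteq> w\<close> by blast
    then show "(c(v := x)) u \<noteq> (c(v := x)) w"
    proof cases
      case 1
      then have "w \<in> nbrs E v" using uw(3) by (simp add: nbrs_def insert_commute)
      then show ?thesis using x 1 by auto
    next
      case 2
      then have "u \<in> nbrs E v" using uw(3) by (simp add: nbrs_def)
      then show ?thesis using x 2 by auto
    next
      case 3
      then have "{u, w} \<in> edges_avoiding v E" using uw(3) by (simp add: edges_avoiding_def)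
      then show ?thesis using c uw 3 unfolding proper_colouring_def by simp
    qed
  qed
  then show ?thesis by blast
qed

section \<open>Drawings whose vertices are path-connected sets\<close>

text \<open>
  The tripod with its three feet indexed by the set \<open>I\<close>, as it is used inside a
  vertex that is joined to three others.
\<close>

lemma tripod_indexed:
  assumes X: "path_connected X" and I: "card I = 3" and x: "\<And>j. j \<in> I \<Longrightarrow> x j \<in> X"
  shows "\<exists>w A. w \<in> X \<and> (\<forall>j\<in>I. link (A j) w (x j) \<and> A j \<subseteq> X)
    \<and> (\<forall>j\<in>I. \<forall>k\<in>I. j \<noteq> k \<longrightarrow> A j \<inter> A k = {w})"
proof -
  obtain i j k where ijk: "I = {i, j, k}" "i \<noteq> j" "j \<noteq> k" "i \<noteq> k"
    using I by (auto simp: card_3_iff)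
  obtain w A B C where w: "link A w (x i)" "link B w (x j)" "link C w (x k)"
    "A \<union> B \<union> C \<subseteq> X" "A \<inter> B = {w}" "A \<inter> C = {w}" "B \<inter> C = {w}"
    using tripod[OF X x x x, of i j k] ijk(1) by auto
  define D where "D = (\<lambda>l. if l = i then A else if l = j then B else C)"
  have D: "D i = A" "D j = B" "D k = C" using ijk by (auto simp: D_def)
  have "w \<in> X" using w by blast
  moreover have "\<forall>j\<in>I. link (D j) w (x j) \<and> D j \<subseteq> X"
    unfolding ijk(1) using w(1-4) D by simp
  moreover have "\<forall>j\<in>I. \<forall>k\<in>I. j \<noteq> k \<longrightarrow> D j \<inter> D k = {w}"
    unfolding ijk(1) using w(5-7) D by (simp add: Int_commute)
  ultimately show ?thesis by blast
qed

text \<open>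
  In each of the first four sets \<open>Y i\<close> a tripod joins the three points where
  the arcs to the other three arrive. Tripods and arcs together form a plane drawing of the
  complete graph on four vertices, with the centres \<open>w i\<close> of the tripods as
  vertices. A point of the fifth set is joined to each \<open>w m\<close> by the connected
  set \<open>Y 4 \<union> M 4 m \<union> Y m\<close>, which misses the opposite triangle;
  this contradicts the previous theorem.
\<close>

lemma no_thick_K5_indexed:
  fixes Y :: "nat \<Rightarrow> complex set" and M :: "nat \<Rightarrow> nat \<Rightarrow> complex set"
  assumes Y: "\<And>i. i < 5 \<Longrightarrow> path_connected (Y i)"
    and Yne: "Y 4 \<noteq> {}"
    and Y_disj: "\<And>i j. \<lbrakk>i < 5; j < 5; i \<noteq> j\<rbrakk> \<Longrightarrow> Y i \<inter> Y j = {}"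
    and M: "\<And>i j. \<lbrakk>i < 5; j < 5; i \<noteq> j\<rbrakk> \<Longrightarrow> arc_between (M i j) (x i j) (x j i)"
    and M_sym: "\<And>i j. M i j = M j i"
    and MY: "\<And>i j. \<lbrakk>i < 5; j < 5; i \<noteq> j\<rbrakk> \<Longrightarrow> M i j \<inter> (\<Union>k<5. Y k) \<subseteq> {x i j, x j i}"
    and xY: "\<And>i j. \<lbrakk>i < 5; j < 5; i \<noteq> j\<rbrakk> \<Longrightarrow> x i j \<in> Y i"
    and MM: "\<And>i j k l. \<lbrakk>i < 5; j < 5; k < 5; l < 5; i \<noteq> j; k \<noteq> l; {i, j} \<noteq> {k, l}\<rbrakk>
        \<Longrightarrow> M i j \<inter> M k l \<subseteq> (\<Union>k<5. Y k)"
  shows False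
proof -
  have MYk: "M i j \<inter> Y k = (if k = i then {x i j} else if k = j then {x j i} else {})"
    if "i < 5" "j < 5" "k < 5" "i \<noteq> j" for i j k
  proof -
    have "M i j \<inter> Y k \<subseteq> {x i j, x j i} \<inter> Y k" using MY[of i j] that by blast
    moreover have "x i j \<in> Y i" "x j i \<in> Y j" using xY that by auto
    moreover have "x i j \<in> M i j" "x j i \<in> M i j" using M[of i j] arc_between_ends that by auto
    moreover have "i' \<noteq> k \<Longrightarrow> Y i' \<inter> Y k = {}" if "i' < 5" for i'
      using Y_disj[of i' k] that \<open>k < 5\<close> by simp
    note this[of i] this[of j] Y_disj[of i j]
    ultimately show ?thesis using that by (cases "k = i"; cases "k = j"; simp; blast)
  qed
  define I where "I = (\<lambda>i. {..<4} - {i::nat})"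
  define legs where "legs = (\<lambda>i w A. w \<in> Y i \<and> (\<forall>j\<in>I i. link (A j) w (x i j) \<and> A j \<subseteq> Y i)
    \<and> (\<forall>j\<in>I i. \<forall>k\<in>I i. j \<noteq> k \<longrightarrow> A j \<inter> A k = {w}))"
  have "\<exists>w A. legs i w A" if "i < 4" for i
    unfolding legs_def using that Y xY by (intro tripod_indexed) (auto simp: I_def)
  then have "\<exists>w. \<forall>i<4. \<exists>A. legs i (w i) A" by (intro choice) blast
  then obtain w where "\<forall>i<4. \<exists>A. legs i (w i) A" by blast
  then have "\<exists>A. \<forall>i<4. legs i (w i) (A i)" by (intro choice) blast
  then obtain A where legs: "legs i (w i) (A i)" if "i < 4" for i by blast
  have w: "\<And>i. i < 4 \<Longrightarrow> w i \<in> Y i"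
    and A: "\<And>i j. \<lbrakk>i < 4; j \<in> I i\<rbrakk> \<Longrightarrow> link (A i j) (w i) (x i j)"
    and AY: "\<And>i j. \<lbrakk>i < 4; j \<in> I i\<rbrakk> \<Longrightarrow> A i j \<subseteq> Y i"
    and AA: "\<And>i j k. \<lbrakk>i < 4; j \<in> I i; k \<in> I i; j \<noteq> k\<rbrakk> \<Longrightarrow> A i j \<inter> A i k = {w i}"
    using legs unfolding legs_def by blast+
  define e where "e = (\<lambda>i j. A i j \<union> M i j \<union> A j i)"
  have xA: "x i j \<in> A i j" and wA: "w i \<in> A i j" if "i < 4" "j < 4" "i \<noteq> j" for i j
    using link_ends[OF A[of i j]] that by (auto simp: I_def)
  have AY': "A i j \<subseteq> Y i" if "i < 4" "j < 4" "i \<noteq> j" for i j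
    using AY[of i j] that by (auto simp: I_def)
  have AA': "A i j \<inter> A i k = {w i}" if "i < 4" "j < 4" "k < 4" "distinct [i, j, k]" for i j k
    using AA[of i j k] that by (auto simp: I_def)
  have MY': "M i j \<inter> Y i = {x i j}" "M j i \<inter> Y i = {x i j}"
    if "i < 5" "j < 5" "i \<noteq> j" for i j
    using MYk[of i j i] MYk[of j i i] that by auto
  have MY0: "M i j \<inter> Y k = {}" if "i < 5" "j < 5" "k < 5" "distinct [i, j, k]" for i j k
    using MYk[of i j k] that by auto
  have eY: "e i j \<inter> Y k = {}" if "i < 4" "j < 4" "k < 5" "distinct [i, j, k]" for i j k
    using MY0[of i j k] AY'[of i j] AY'[of j i] Y_disj[of i k] Y_disj[of j k] that
    unfolding e_def by auto
  have eM: "e i j \<inter> M k l = {}" if "i < 4" "j < 4" "k < 5" "l < 5" "distinct [i, j, k, l]" for i j k l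
  proof -
    have "A i j \<inter> M k l = {}" "A j i \<inter> M k l = {}"
      using AY'[of i j] AY'[of j i] MY0[of k l i] MY0[of k l j] that by auto
    moreover have "M i j \<inter> M k l \<subseteq> {x i j, x j i} \<inter> {x k l, x l k}"
      using MM[of i j k l] MY[of i j] MY[of k l] that by (auto simp: doubleton_eq_iff)
    moreover have "{x i j, x j i} \<inter> {x k l, x l k} = {}"
    proof -
      have "x i j \<in> Y i" "x j i \<in> Y j" "x k l \<in> Y k" "x l k \<in> Y l"
        using xY that by auto
      moreover have "Y i \<inter> Y k = {}" "Y i \<inter> Y l = {}" "Y j \<inter> Y k = {}" "Y j \<inter> Y l = {}"
        using Y_disj that by auto
      ultimately show ?thesis by auto
    qed
    ultimately have "A i j \<inter> M k l = {}" "A j i \<inter> M k l = {}" "M i j \<inter> M k l = {}" by auto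
    then show ?thesis unfolding e_def by (simp only: Int_Un_distrib2 Un_empty)
  qed
  interpret plane_K4 w e
  proof
    fix i j :: nat assume ij: "i < 4" "j < 4" "i \<noteq> j"
    have "link (M i j) (x i j) (x j i)" using M[of i j] ij by (simp add: link_def)
    moreover have "link (A i j) (w i) (x i j)" "link (A j i) (x j i) (w j)"
      using A[of i j] link_sym[OF A[of j i]] ij by (auto simp: I_def)
    moreover have "A i j \<inter> M i j = {x i j}"
      using MY'(1)[of i j] AY'[of i j] xA[of i j] ij by auto
    moreover have "(A i j \<union> M i j) \<inter> A j i = {x j i}"
      using MY'(2)[of j i] AY'[of j i] AY'[of i j] xA[of j i] Y_disj[of i j] ij by auto
    ultimately have "link (e i j) (w i) (w j)"
      unfolding e_def using link_join by metis
    moreover have "w i \<noteq> w j" using w[of i] w[of j] Y_disj[of i j] ij by auto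
    ultimately show "arc_between (e i j) (w i) (w j)" by (rule arc_between_link)
    show "e i j = e j i" using M_sym by (auto simp: e_def)
  next
    fix i j k :: nat assume ijk: "i < 4" "j < 4" "k < 4" "distinct [i, j, k]"
    have d: "i \<noteq> j" "j \<noteq> k" "i \<noteq> k" "{i, j} \<noteq> {i, k}" using ijk by (auto simp: doubleton_eq_iff)
    have Yijk: "Y i \<inter> Y j = {}" "Y i \<inter> Y k = {}" "Y j \<inter> Y k = {}" using Y_disj ijk d by auto
    have xs: "x i j \<in> Y i" "x i k \<in> Y i" "x j i \<in> Y j" "x k i \<in> Y k" using xY ijk d by auto
    have s: "A i j \<subseteq> Y i" "A i k \<subseteq> Y i" "A j i \<subseteq> Y j" "A k i \<subseteq> Y k" using AY' ijk d by auto
    have AM: "A i j \<inter> M i k \<subseteq> {x i k}" "M i j \<inter> A i k \<subseteq> {x i j}"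
      using MY'(1)[of i k] MY'(1)[of i j] s ijk d by auto
    have "M i j \<inter> M i k \<subseteq> {x i j, x j i} \<inter> {x i k, x k i}"
      using MM[of i j i k] MY[of i j] MY[of i k] ijk d by auto
    moreover have "x j i \<noteq> x i k" "x j i \<noteq> x k i" "x k i \<noteq> x i j" using xs Yijk by auto
    ultimately have "M i j \<inter> M i k \<subseteq> {x i j} \<inter> {x i k}" by auto
    moreover have "A i j \<inter> A k i = {}" "A j i \<inter> A i k = {}" "A j i \<inter> A k i = {}"
      "M i j \<inter> A k i = {}" "A j i \<inter> M i k = {}"
      using MY0[of i j k] MY0[of i k j] s ijk d Yijk by auto
    moreover have "x i j \<in> A i j" "x i k \<in> A i k" "w i \<in> A i j" using xA wA ijk d by auto
    moreover note AM
    ultimately have "e i j \<inter> e i k \<subseteq> A i j \<inter> A i k"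
      unfolding e_def by (simp only: Int_Un_distrib Int_Un_distrib2) auto
    moreover have "A i j \<inter> A i k \<subseteq> e i j \<inter> e i k" unfolding e_def by blast
    ultimately have "e i j \<inter> e i k = A i j \<inter> A i k" by (rule equalityI)
    then show "e i j \<inter> e i k = {w i}" unfolding AA'[OF ijk] .
  next
    fix i j k l :: nat assume ijkl: "i < 4" "j < 4" "k < 4" "l < 4" "distinct [i, j, k, l]"
    have "e i j \<inter> Y k = {}" "e i j \<inter> Y l = {}" "e i j \<inter> M k l = {}"
      using eY[of i j k] eY[of i j l] eM[of i j k l] ijkl by auto
    moreover have "A k l \<subseteq> Y k" "A l k \<subseteq> Y l" using AY' ijkl by auto
    ultimately show "e i j \<inter> e k l = {}" by (auto simp: e_def)
  qed
  obtain z where z: "z \<in> Y 4" using Yne by auto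
  have join: "\<exists>S. connected S \<and> z \<in> S \<and> w m \<in> S \<and> S \<inter> face m = {}" if m: "m < 4" for m
  proof -
    let ?S = "Y 4 \<union> M 4 m \<union> Y m"
    have "Y 4 \<inter> M 4 m \<noteq> {}" "(Y 4 \<union> M 4 m) \<inter> Y m \<noteq> {}"
      using MY'(1)[of 4 m] MY'(2)[of m 4] m by auto
    then have "path_connected ?S"
      using Y arc_between_path_connected[OF M[of 4 m]] m by (intro path_connected_Un) auto
    then have "connected ?S" by (rule path_connected_imp_connected)
    moreover have "e i j \<inter> ?S = {}" if "i < 4" "j < 4" "distinct [i, j, m]" for i j
      using eY[of i j 4] eY[of i j m] eM[of i j 4 m] that m by auto
    then have "?S \<inter> face m = {}" unfolding face_def by fastforce
    ultimately show ?thesis using z w[OF m] by blast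
  qed
  show False
  proof (rule no_point_sees_all_vertices[of z])
    fix m :: nat assume "m < 4"
    then obtain S where S: "connected S" "z \<in> S" "w m \<in> S" "S \<inter> face m = {}" using join by blast
    show "z \<notin> face m" using S by blast
    show "z \<in> inside (face m) \<longleftrightarrow> w m \<in> inside (face m)"
      using connected_subset_inside[OF S(1,4)] S(2,3) by blast
  qed
qed

text \<open>
  A drawing in which the vertices are disjoint path-connected sets instead of points. Such
  drawings survive the contraction of an edge: the two sets and the arc between them are
  united to a single set. Thus contractions of planar graphs are covered without any
  deformation of the plane.
\<close>

definition thick_drawing ::
    "'a set \<Rightarrow> 'a set set \<Rightarrow> ('a \<Rightarrow> complex set) \<Rightarrow> ('a set \<Rightarrow> complex set) \<Rightarrow> bool" where
  "thick_drawing V E X L \<longleftrightarrow>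
     (\<forall>v\<in>V. path_connected (X v) \<and> X v \<noteq> {}) \<and>
     (\<forall>u\<in>V. \<forall>v\<in>V. u \<noteq> v \<longrightarrow> X u \<inter> X v = {}) \<and>
     (\<forall>e\<in>E. \<exists>u v x y. e = {u, v} \<and> x \<in> X u \<and> y \<in> X v \<and> arc_between (L e) x y \<and>
        L e \<inter> (\<Union>w\<in>V. X w) \<subseteq> {x, y}) \<and>
     (\<forall>e\<in>E. \<forall>e'\<in>E. e \<noteq> e' \<longrightarrow> L e \<inter> L e' \<subseteq> (\<Union>w\<in>V. X w))"

lemma thick_drawing_vertex:
  assumes "thick_drawing V E X L" "v \<in> V"
  shows "path_connected (X v)" "X v \<noteq> {}"
  using assms unfolding thick_drawing_def by (elim conjE, simp)+

lemma thick_drawing_disjoint: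
  assumes "thick_drawing V E X L" "u \<in> V" "v \<in> V" "u \<noteq> v"
  shows "X u \<inter> X v = {}"
  using assms unfolding thick_drawing_def by (elim conjE) simp

lemma thick_drawing_edge_ex:
  assumes "thick_drawing V E X L" "e \<in> E"
  shows "\<exists>u v x y. e = {u, v} \<and> x \<in> X u \<and> y \<in> X v \<and> arc_between (L e) x y \<and>
        L e \<inter> (\<Union>w\<in>V. X w) \<subseteq> {x, y}"
  using assms unfolding thick_drawing_def by (elim conjE) (rule bspec)

lemma thick_drawing_edges_meet:
  assumes "thick_drawing V E X L" "e \<in> E" "e' \<in> E" "e \<noteq> e'"
  shows "L e \<inter> L e' \<subseteq> (\<Union>w\<in>V. X w)"
  using assms unfolding thick_drawing_def by (elim conjE) simp

lemma thick_drawing_edge: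
  assumes D: "thick_drawing V E X L" and e: "{u, v} \<in> E" "u \<noteq> v"
  shows "\<exists>x y. x \<in> X u \<and> y \<in> X v \<and> arc_between (L {u, v}) x y \<and>
        L {u, v} \<inter> (\<Union>w\<in>V. X w) \<subseteq> {x, y}"
proof -
  obtain u' v' x y where *: "{u, v} = {u', v'}" "x \<in> X u'" "y \<in> X v'" "arc_between (L {u, v}) x y"
        "L {u, v} \<inter> (\<Union>w\<in>V. X w) \<subseteq> {x, y}"
    using thick_drawing_edge_ex[OF D e(1)] by blast
  show ?thesis
  proof (cases "u = u'")
    case True
    then have "v = v'" using * e by (auto simp: doubleton_eq_iff)
    then show ?thesis using * True by blast
  next
    case False
    then have "u = v'" "v = u'" using * e by (auto simp: doubleton_eq_iff)
    then show ?thesis using * arc_between_sym[OF *(4)] by blast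
  qed
qed

lemma planar_imp_thick_drawing:
  assumes "finite_simple_graph V E" "planar V E"
  shows "\<exists>X L. thick_drawing V E X L"
proof -
  obtain p \<gamma> where d: "plane_drawing V E p \<gamma>" using assms(2) by (auto simp: planar_def)
  have inj: "inj_on p V" using d by (auto simp: plane_drawing_def)
  have "thick_drawing V E (\<lambda>v. {p v}) (\<lambda>e. path_image (\<gamma> e))"
    unfolding thick_drawing_def
  proof (intro conjI ballI impI)
    fix u v assume "u \<in> V" "v \<in> V" "u \<noteq> v"
    then show "{p u} \<inter> {p v} = {}" using inj by (auto simp: inj_on_def)
  next
    fix e assume e: "e \<in> E"
    then have "e \<subseteq> V" "card e = 2" using assms(1) by (auto simp: finite_simple_graph_def)
    then obtain u v where uv: "e = {u, v}" by (auto simp: card_2_iff)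
    have g: "arc (\<gamma> e)" "{pathstart (\<gamma> e), pathfinish (\<gamma> e)} = p ` e"
      "path_image (\<gamma> e) \<inter> p ` V = p ` e"
      using d e by (auto simp: plane_drawing_def)
    have "arc_between (path_image (\<gamma> e)) (p u) (p v)"
    proof (cases "pathstart (\<gamma> e) = p u")
      case True
      then have "pathfinish (\<gamma> e) = p v" 
        using g(2) arc_distinct_ends[OF g(1)] uv by (auto simp: doubleton_eq_iff)
      then show ?thesis using True g(1) by (auto simp: arc_between_def)
    next
      case False
      then have "pathstart (\<gamma> e) = p v" "pathfinish (\<gamma> e) = p u" 
        using g(2) uv by (auto simp: doubleton_eq_iff)
      then have "arc_between (path_image (\<gamma> e)) (p v) (p u)" using g(1) by (auto simp: arc_between_def)
      then show ?thesis by (rule arc_between_sym)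
    qed
    then show "\<exists>u v x y. e = {u, v} \<and> x \<in> {p u} \<and> y \<in> {p v} \<and> arc_between (path_image (\<gamma> e)) x y \<and>
        path_image (\<gamma> e) \<inter> (\<Union>w\<in>V. {p w}) \<subseteq> {x, y}"
      using g(3) uv by (intro exI[of _ u] exI[of _ v] exI[of _ "p u"] exI[of _ "p v"]) auto
  next
    fix e e' assume e: "e \<in> E" "e' \<in> E" "e \<noteq> e'"
    then have "path_image (\<gamma> e) \<inter> path_image (\<gamma> e') = p ` (e \<inter> e')" "e \<subseteq> V"
      using d assms(1) by (auto simp: plane_drawing_def finite_simple_graph_def)
    then show "path_image (\<gamma> e) \<inter> path_image (\<gamma> e') \<subseteq> (\<Union>w\<in>V. {p w})" by auto
  qed auto
  then show ?thesis by blast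
qed

text \<open>
  An edge can meet the set of a removed vertex only in its own end points, so two edges that
  met inside such a set did not meet at all.
\<close>

lemma thick_drawing_subgraph:
  assumes D: "thick_drawing V E X L" and sub: "V' \<subseteq> V" "E' \<subseteq> E" "\<And>e. e \<in> E' \<Longrightarrow> e \<subseteq> V'"
  shows "thick_drawing V' E' X L"
proof -
  have edge: "\<exists>u v x y. e = {u, v} \<and> x \<in> X u \<and> y \<in> X v \<and> arc_between (L e) x y \<and>
        L e \<inter> (\<Union>w\<in>V. X w) \<subseteq> {x, y}" if "e \<in> E'" for e
    using thick_drawing_edge_ex[OF D] sub(2) that by auto
  have meets: "L e \<inter> (\<Union>w\<in>V. X w) \<subseteq> (\<Union>w\<in>V'. X w)" if e: "e \<in> E'" for e
  proof -
    obtain u v x y where "e = {u, v}" "x \<in> X u" "y \<in> X v" "L e \<inter> (\<Union>w\<in>V. X w) \<subseteq> {x, y}"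
      using edge[OF e] by blast
    moreover have "e \<subseteq> V'" using sub(3)[OF e] .
    ultimately show ?thesis by auto
  qed
  have UV: "(\<Union>w\<in>V'. X w) \<subseteq> (\<Union>w\<in>V. X w)" using sub(1) by auto
  show ?thesis
    unfolding thick_drawing_def
  proof (intro conjI ballI impI)
    fix e assume "e \<in> E'"
    from edge[OF this] obtain u v x y where "e = {u, v}" "x \<in> X u" "y \<in> X v"
      "arc_between (L e) x y" "L e \<inter> (\<Union>w\<in>V. X w) \<subseteq> {x, y}" by blast
    moreover from this(5) have "L e \<inter> (\<Union>w\<in>V'. X w) \<subseteq> {x, y}" using UV by blast
    ultimately show "\<exists>u v x y. e = {u, v} \<and> x \<in> X u \<and> y \<in> X v \<and> arc_between (L e) x y \<and>
        L e \<inter> (\<Union>w\<in>V'. X w) \<subseteq> {x, y}"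
      by (intro exI[of _ u] exI[of _ v] exI[of _ x] exI[of _ y] conjI)
  next
    fix e e' assume e: "e \<in> E'" "e' \<in> E'" "e \<noteq> e'"
    then have "L e \<inter> L e' \<subseteq> (\<Union>w\<in>V. X w)"
      using thick_drawing_edges_meet[OF D, of e e'] sub(2) by auto
    then show "L e \<inter> L e' \<subseteq> (\<Union>w\<in>V'. X w)" using meets[OF e(1)] by blast
  qed (use thick_drawing_vertex[OF D] thick_drawing_disjoint[OF D] sub(1) in \<open>simp_all add: subset_eq\<close>)
qed

lemma thick_drawing_contract:
  assumes D: "thick_drawing V E X L" and G: "finite_simple_graph V E" and ab: "{a, b} \<in> E" "a \<noteq> b"
  shows "\<exists>X L. thick_drawing (V - {b}) (contract a b E) X L"
proof -
  have abV: "a \<in> V" "b \<in> V" using G ab by (auto simp: finite_simple_graph_def)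
  define X' where "X' = X(a := X a \<union> L {a, b} \<union> X b)"
  \<comment> \<open>Each contracted edge is drawn as one of the edges from which it arises.\<close>
  define lift where "lift = (\<lambda>e'. SOME e. e \<in> E \<and> e' = merge a b ` e)"
  have lift: "lift e' \<in> E" "e' = merge a b ` lift e'" "card e' = 2" if "e' \<in> contract a b E" for e'
    using that someI_ex[of "\<lambda>e. e \<in> E \<and> e' = merge a b ` e"]
    by (auto simp: contract_def lift_def)
  have lift_ab: "lift e' \<noteq> {a, b}" if "e' \<in> contract a b E" for e'
  proof
    assume "lift e' = {a, b}"
    then have "e' = {a}" using lift(2)[OF that] ab(2) by (auto simp: merge_def)
    then show False using lift(3)[OF that] by simp
  qed
  obtain x y where xy: "x \<in> X a" "y \<in> X b" "arc_between (L {a, b}) x y"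
        "L {a, b} \<inter> (\<Union>w\<in>V. X w) \<subseteq> {x, y}"
    using thick_drawing_edge[OF D ab] by blast
  have disj: "X u \<inter> X v = {}" if "u \<in> V" "v \<in> V" "u \<noteq> v" for u v
    by (rule thick_drawing_disjoint[OF D that])
  have disj': "X' a \<inter> X v = {}" if "v \<in> V" "v \<noteq> a" "v \<noteq> b" for v
  proof -
    have "X a \<inter> X v = {}" "X b \<inter> X v = {}" using disj abV that by auto
    moreover have "L {a, b} \<inter> X v \<subseteq> {x, y}" using xy(4) that by blast
    ultimately show ?thesis using xy(1,2) unfolding X'_def by auto
  qed
  have U: "(\<Union>w\<in>V - {b}. X' w) = (\<Union>w\<in>V. X w) \<union> L {a, b}"
    using abV ab(2) by (auto simp: X'_def split: if_splits)
  have pc: "path_connected (X v)" "X v \<noteq> {}" if "v \<in> V" for v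
    by (rule thick_drawing_vertex[OF D that])+
  have XX': "X u \<subseteq> X' (merge a b u)" for u by (auto simp: X'_def merge_def)
  have edge: "\<exists>u v x y. e = {u, v} \<and> x \<in> X u \<and> y \<in> X v \<and> arc_between (L e) x y \<and>
        L e \<inter> (\<Union>w\<in>V. X w) \<subseteq> {x, y}" if "e \<in> E" for e
    by (rule thick_drawing_edge_ex[OF D that])
  have meet: "L e \<inter> L e' \<subseteq> (\<Union>w\<in>V. X w)" if "e \<in> E" "e' \<in> E" "e \<noteq> e'" for e e'
    by (rule thick_drawing_edges_meet[OF D that])
  have "thick_drawing (V - {b}) (contract a b E) X' (L \<circ> lift)"
    unfolding thick_drawing_def
  proof (intro conjI ballI impI)
    fix v assume v: "v \<in> V - {b}"
    have "X a \<inter> L {a, b} \<noteq> {}" "(X a \<union> L {a, b}) \<inter> X b \<noteq> {}"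
      using xy arc_between_ends[OF xy(3)] by auto
    then have "path_connected (X a \<union> L {a, b} \<union> X b)"
      using pc abV arc_between_path_connected[OF xy(3)] by (intro path_connected_Un) auto
    then show "path_connected (X' v)" using pc v by (auto simp: X'_def)
    show "X' v \<noteq> {}" using pc v by (auto simp: X'_def)
  next
    fix u v assume uv: "u \<in> V - {b}" "v \<in> V - {b}" "u \<noteq> v"
    show "X' u \<inter> X' v = {}"
    proof (cases "u = a \<or> v = a")
      case True
      then show ?thesis using disj'[of u] disj'[of v] uv by (auto simp: X'_def)
    next
      case False
      then show ?thesis using disj uv by (auto simp: X'_def)
    qed
  next
    fix e' assume e': "e' \<in> contract a b E"
    let ?e = "lift e'"
    obtain u v p q where e: "?e = {u, v}" "p \<in> X u" "q \<in> X v" "arc_between (L ?e) p q"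
      "L ?e \<inter> (\<Union>w\<in>V. X w) \<subseteq> {p, q}"
      using edge[OF lift(1)[OF e']] by blast
    have "L ?e \<inter> L {a, b} \<subseteq> (\<Union>w\<in>V. X w)" 
      by (rule meet[OF lift(1)[OF e'] ab(1) lift_ab[OF e']])
    then have "L ?e \<inter> (\<Union>w\<in>V - {b}. X' w) \<subseteq> {p, q}" using e(5) unfolding U by blast
    moreover have "e' = {merge a b u, merge a b v}" using lift(2)[OF e'] e(1) by simp
    moreover have "p \<in> X' (merge a b u)" "q \<in> X' (merge a b v)" using e(2,3) XX' by auto
    ultimately show "\<exists>u v x y. e' = {u, v} \<and> x \<in> X' u \<and> y \<in> X' v \<and>
        arc_between ((L \<circ> lift) e') x y \<and> (L \<circ> lift) e' \<inter> (\<Union>w\<in>V - {b}. X' w) \<subseteq> {x, y}"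
      using e(4) unfolding o_apply
      by (intro exI[of _ "merge a b u"] exI[of _ "merge a b v"] exI[of _ p] exI[of _ q] conjI)
  next
    fix e e' assume e: "e \<in> contract a b E" "e' \<in> contract a b E" "e \<noteq> e'"
    then have "lift e \<noteq> lift e'" using lift(2) by metis
    then have "L (lift e) \<inter> L (lift e') \<subseteq> (\<Union>w\<in>V. X w)" 
      by (intro meet lift(1) e(1,2))
    then show "(L \<circ> lift) e \<inter> (L \<circ> lift) e' \<subseteq> (\<Union>w\<in>V - {b}. X' w)" unfolding U by auto
  qed
  then show ?thesis by blast
qed

lemma thick_drawing_no_K5:
  assumes D: "thick_drawing V E X L" and K: "clique V E K" "card K = 5"
  shows False
proof -
  have finK: "finite K" using K(2) card.infinite by fastforce
  then obtain q :: "nat \<Rightarrow> 'a" where q: "bij_betw q {..<5} K"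
    using K(2) ex_bij_betw_nat_finite[OF finK] unfolding atLeast0LessThan by metis
  have qK: "q i \<in> K" "q i \<in> V" if "i < 5" for i
    using q K(1) that by (auto simp: bij_betw_def clique_def)
  have qeq: "q i = q j \<longleftrightarrow> i = j" if "i < 5" "j < 5" for i j
    using q that by (auto simp: bij_betw_def inj_on_def)
  have qE: "{q i, q j} \<in> E" if "i < 5" "j < 5" "i \<noteq> j" for i j
    using K(1) qK qeq that by (auto simp: clique_def)
  \<comment> \<open>The point \<open>x i j\<close> is the only point of the edge \<open>M i j\<close> in the
    set of the vertex \<open>q i\<close>.\<close>
  define M where "M = (\<lambda>i j. L {q i, q j})"
  define x where "x = (\<lambda>i j. SOME z. z \<in> X (q i) \<inter> L {q i, q j})"
  have disj: "X u \<inter> X v = {}" if "u \<in> V" "v \<in> V" "u \<noteq> v" for u v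
    by (rule thick_drawing_disjoint[OF D that])
  have x: "x i j \<in> X (q i)" "x j i \<in> X (q j)" "arc_between (M i j) (x i j) (x j i)"
      "M i j \<inter> (\<Union>w\<in>V. X w) \<subseteq> {x i j, x j i}" if ij: "i < 5" "j < 5" "i \<noteq> j" for i j
  proof -
    obtain a b where ab: "a \<in> X (q i)" "b \<in> X (q j)" "arc_between (L {q i, q j}) a b"
      "L {q i, q j} \<inter> (\<Union>w\<in>V. X w) \<subseteq> {a, b}"
      using thick_drawing_edge[OF D qE[OF ij]] qeq ij by auto
    have "X (q i) \<inter> X (q j) = {}" using disj qK qeq ij by auto
    then have "b \<notin> X (q i)" "a \<notin> X (q j)" using ab by auto
    moreover have "X (q i) \<union> X (q j) \<subseteq> (\<Union>w\<in>V. X w)" using qK ij by auto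
    ultimately have "X (q i) \<inter> L {q i, q j} = {a}" "X (q j) \<inter> L {q j, q i} = {b}"
      using ab arc_between_ends[OF ab(3)] unfolding insert_commute[of "q j"] by blast+
    then have "x i j = a" "x j i = b" unfolding x_def by auto
    then show "x i j \<in> X (q i)" "x j i \<in> X (q j)" "arc_between (M i j) (x i j) (x j i)"
      "M i j \<inter> (\<Union>w\<in>V. X w) \<subseteq> {x i j, x j i}"
      using ab by (auto simp: M_def)
  qed
  have K5: "(\<Union>k<5. X (q k)) \<subseteq> (\<Union>w\<in>V. X w)" using qK by auto
  show False
  proof (rule no_thick_K5_indexed[of "\<lambda>i. X (q i)" M x])
    fix i j k l :: nat
    assume a: "i < 5" "j < 5" "k < 5" "l < 5" "i \<noteq> j" "k \<noteq> l" "{i, j} \<noteq> {k, l}"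
    then have "{q i, q j} \<noteq> {q k, q l}" using qeq by (auto simp: doubleton_eq_iff)
    then have "M i j \<inter> M k l \<subseteq> (\<Union>w\<in>V. X w)"
      unfolding M_def using thick_drawing_edges_meet[OF D qE qE] a by simp
    moreover have "M i j \<inter> (\<Union>w\<in>V. X w) \<subseteq> {x i j, x j i}" "x i j \<in> X (q i)" "x j i \<in> X (q j)"
      using x a by auto
    ultimately show "M i j \<inter> M k l \<subseteq> (\<Union>k<5. X (q k))" using a(1,2) by blast
  next
    fix i j :: nat assume a: "i < 5" "j < 5" "i \<noteq> j"
    show "M i j \<inter> (\<Union>k<5. X (q k)) \<subseteq> {x i j, x j i}" using x(4)[OF a] K5 by blast
    show "X (q i) \<inter> X (q j) = {}" using disj qK qeq a by auto
  next
    show "M i j = M j i" for i j by (simp add: M_def insert_commute)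
  qed (use x qK thick_drawing_vertex[OF D] in auto)
qed

section \<open>Density and colourings in the absence of a complete minor on five vertices\<close>

text \<open>
  A class of finite simple graphs that is closed under subgraphs and edge contractions and
  contains no graph with five pairwise adjacent vertices. Two instances are needed: the
  planar graphs, and the planar graphs with an interval model of bounded width.
\<close>

locale K5_minor_free_class =
  fixes P :: "'a set \<Rightarrow> 'a set set \<Rightarrow> bool"
  assumes graph: "P V E \<Longrightarrow> finite_simple_graph V E"
    and subgraph: "\<lbrakk>P V E; V' \<subseteq> V; E' \<subseteq> E; \<And>e. e \<in> E' \<Longrightarrow> e \<subseteq> V'\<rbrakk> \<Longrightarrow> P V' E'"
    and contract: "\<lbrakk>P V E; {a, b} \<in> E; a \<noteq> b\<rbrakk> \<Longrightarrow> P (V - {b}) (contract a b E)"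
    and no_K5: "\<lbrakk>P V E; clique V E K\<rbrakk> \<Longrightarrow> card K \<noteq> 5"
begin

lemma delete_vertex: "P V E \<Longrightarrow> P (V - {v}) (edges_avoiding v E)"
  by (rule subgraph) (use graph in \<open>auto simp: edges_avoiding_def finite_simple_graph_def\<close>)

lemma delete_edge: "P V E \<Longrightarrow> P V (E - {e})"
  by (rule subgraph) (use graph in \<open>auto simp: finite_simple_graph_def\<close>)

lemma nonadjacent_neighbours:
  assumes P: "P V E" and v: "v \<in> V" "4 \<le> card (nbrs E v)"
  shows "\<exists>a\<in>nbrs E v. \<exists>b\<in>nbrs E v. a \<noteq> b \<and> {a, b} \<notin> E"
proof (rule ccontr)
  assume "\<not> ?thesis"
  then have all: "{a, b} \<in> E" if "a \<in> nbrs E v" "b \<in> nbrs E v" "a \<noteq> b" for a b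
    using that by blast
  note G = graph[OF P]
  obtain S where S: "S \<subseteq> nbrs E v" "card S = 4" "finite S"
    using obtain_subset_with_card_n[OF v(2)] by metis
  have "v \<notin> S" using S(1) nbrs_subset[OF G] by auto
  then have "card (insert v S) = 5" using S by simp
  moreover have "clique V E (insert v S)"
    unfolding clique_def
  proof (intro conjI ballI impI)
    show "insert v S \<subseteq> V" using S(1) nbrs_subset[OF G] v(1) by auto
    fix a b assume "a \<in> insert v S" "b \<in> insert v S" "a \<noteq> b"
    moreover have "{v, x} \<in> E" "{x, v} \<in> E" if "x \<in> S" for x
      using that S(1) by (auto simp: nbrs_def insert_commute)
    moreover have "{x, y} \<in> E" if "x \<in> S" "y \<in> S" "x \<noteq> y" for x y
      using all[of x y] that S(1) by blast
    ultimately show "{a, b} \<in> E" by (elim insertE) simp_all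
  qed
  ultimately show False using no_K5[OF P] by simp
qed

text \<open>
  Take a vertex \<open>v\<close> of degree at most \<open>k\<close>. If its degree is
  smaller, colour the rest first. If it is \<open>k \<ge> 4\<close>, then two neighbours
  \<open>a\<close> and \<open>b\<close> of \<open>v\<close> are not adjacent, for otherwise
  \<open>v\<close> and four of its neighbours would be pairwise adjacent. Contract
  \<open>v\<close> and \<open>b\<close> into \<open>a\<close> and colour the smaller graph.
  Pulled back, this colours \<open>a\<close> and \<open>b\<close> alike, so the neighbours
  of \<open>v\<close> use at most \<open>k - 1\<close> colours.
\<close>

lemma colourable_if_small_degrees:
  assumes k: "4 \<le> k"
    and deg: "\<And>V E. P V E \<Longrightarrow> V \<noteq> {} \<Longrightarrow> \<exists>v\<in>V. card (nbrs E v) \<le> k"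
    and "P V E"
  shows "\<exists>c. proper_colouring V E k c"
  using \<open>P V E\<close>
proof (induction "card V" arbitrary: V E rule: less_induct)
  case less
  note G = graph[OF less.prems]
  have finV: "finite V" using G by (simp add: finite_simple_graph_def)
  show ?case
  proof (cases "V = {}")
    case True then show ?thesis by (intro exI[of _ "\<lambda>_. 0"]) (simp add: proper_colouring_def)
  next
    case False
    then obtain v where v: "v \<in> V" "card (nbrs E v) \<le> k" using deg less.prems by blast
    have finN: "finite (nbrs E v)" by (rule nbrs_finite[OF G])
    have small: "card (V - {v}) < card V" using finV v(1) by (rule card_Diff1_less)
    show ?thesis
    proof (cases "card (nbrs E v) < k")
      case True
      obtain c where c: "proper_colouring (V - {v}) (edges_avoiding v E) k c"
        using less.hyps[OF small delete_vertex[OF less.prems]] by blast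
      have "card (c ` nbrs E v) < k" using card_image_le[OF finN, of c] True by linarith
      then show ?thesis using extend_colouring[OF G c] by blast
    next
      case False
      then obtain a b where ab: "a \<in> nbrs E v" "b \<in> nbrs E v" "a \<noteq> b" "{a, b} \<notin> E"
        using nonadjacent_neighbours[OF less.prems v(1)] k by fastforce
      have abv: "{a, v} \<in> E" "{b, v} \<in> E" "a \<noteq> v" "b \<noteq> v"
        using ab edge_ne[OF G] by (auto simp: nbrs_def)
      \<comment> \<open>The two contractions make \<open>v\<close> and \<open>b\<close> part of
        \<open>a\<close>; \<open>b\<close> becomes adjacent to \<open>a\<close> by the first
        one.\<close>
      define E1 where "E1 = contract a v E"
      define E2 where "E2 = contract a b E1"
      have P1: "P (V - {v}) E1" unfolding E1_def by (rule contract) fact+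
      have "{b, a} \<in> E1"
        unfolding E1_def using abv ab(3) by (intro contract_merged_edge) auto
      then have "{a, b} \<in> E1" by (simp add: insert_commute)
      then have P2: "P (V - {v} - {b}) E2" unfolding E2_def using contract[OF P1] ab(3) by blast
      have "card (V - {v} - {b}) < card V"
        using small finV by (meson card_Diff1_le finite_Diff le_less_trans)
      then obtain c where c: "proper_colouring (V - {v} - {b}) E2 k c"
        using less.hyps[OF _ P2] by blast
      have bV: "a \<in> V" "b \<in> V" using ab nbrs_subset[OF G] by auto
      define d where "d = c \<circ> merge a b"
      have mV: "merge a b x \<in> V - {v} - {b}" if "x \<in> V - {v}" for x
        using that ab(3) abv(3) bV by (auto simp: merge_def)
      have "proper_colouring (V - {v}) (edges_avoiding v E) k d"
        unfolding proper_colouring_def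
      proof (intro conjI ballI impI)
        fix x assume "x \<in> V - {v}"
        then show "d x < k" using mV c by (auto simp: d_def proper_colouring_def)
      next
        fix x y assume xy: "x \<in> V - {v}" "y \<in> V - {v}" "{x, y} \<in> edges_avoiding v E"
        then have e: "{x, y} \<in> E" by (simp add: edges_avoiding_def)
        have ne: "x \<noteq> y" using edge_ne[OF G e] .
        have "{x, y} \<in> E1"
          unfolding E1_def using xy e ne by (intro contract_unmerged_edge) auto
        moreover have m: "merge a b x \<noteq> merge a b y"
          using ne e ab(4) by (auto simp: merge_def insert_commute)
        ultimately have "{merge a b x, merge a b y} \<in> E2"
          unfolding E2_def by (rule contract_edge)
        then show "d x \<noteq> d y" using c mV[OF xy(1)] mV[OF xy(2)]
          unfolding d_def proper_colouring_def by simp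
      qed
      moreover have "card (d ` nbrs E v) < k"
      proof -
        have "d b \<in> d ` (nbrs E v - {b})"
          using ab by (intro image_eqI[of _ _ a]) (auto simp: d_def merge_def)
        then have "d ` nbrs E v = d ` (nbrs E v - {b})" using ab(2) by blast
        then have "card (d ` nbrs E v) \<le> card (nbrs E v - {b})"
          using card_image_le[of "nbrs E v - {b}" d] finN by simp
        then show ?thesis using card_Diff1_less[OF finN ab(2)] v(2) by linarith
      qed
      ultimately show ?thesis using extend_colouring[OF G] by blast
    qed
  qed
qed

text \<open>
  With four neighbours the hypothesis on common neighbours makes \<open>v\<close> and its
  neighbours pairwise adjacent. With five neighbours, each of them misses at most one of the
  other four, so the missing edges among them form a matching. If only one edge is missing,
  then \<open>v\<close>, one of its ends and the three remaining neighbours are pairwise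
  adjacent. If two disjoint edges \<open>a b\<close> and \<open>c d\<close> are missing,
  then contracting \<open>c\<close> into \<open>a\<close> makes \<open>v, a, b, d\<close>
  and the fifth neighbour \<open>e\<close> pairwise adjacent.
\<close>

lemma no_dense_neighbourhood:
  assumes P: "P V E" and v: "v \<in> V" and N: "card (nbrs E v) = 4 \<or> card (nbrs E v) = 5"
    and common: "\<And>u. u \<in> nbrs E v \<Longrightarrow> 3 \<le> card (nbrs E u \<inter> nbrs E v)"
  shows False
proof -
  note G = graph[OF P]
  define N where "N = nbrs E v"
  have finN: "finite N" and NV: "N \<subseteq> V - {v}"
    using nbrs_finite[OF G] nbrs_subset[OF G] by (auto simp: N_def)
  obtain a b where ab: "a \<in> N" "b \<in> N" "a \<noteq> b" "{a, b} \<notin> E"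
    using nonadjacent_neighbours[OF P v] N unfolding N_def by force
  have few: "card (N - insert u S) \<ge> 3" if "u \<in> N" "\<And>x. x \<in> S \<Longrightarrow> {x, u} \<notin> E" for u S
  proof -
    have "nbrs E u \<inter> N \<subseteq> N - insert u S"
      using that edge_ne[OF G] by (auto simp: nbrs_def)
    then have "card (nbrs E u \<inter> N) \<le> card (N - insert u S)" using finN by (intro card_mono) auto
    then show ?thesis using common[of u] that(1) by (simp add: N_def)
  qed
  have adj: "{u, x} \<in> E" if "u \<in> N" "x \<in> N" "y \<in> N" "u \<noteq> x" "u \<noteq> y" "x \<noteq> y" "{u, y} \<notin> E" for u x y
  proof (rule ccontr)
    assume "{u, x} \<notin> E"
    then have "{x, u} \<notin> E" "{y, u} \<notin> E" using that(7) by (simp_all add: insert_commute)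
    then have "card (N - {u, x, y}) \<ge> 3" using few[of u "{x, y}"] that(1) by blast
    moreover have "card (N - {u, x, y}) = card N - 3" using that by (simp add: card_Diff_subset)
    ultimately show False using N unfolding N_def by linarith
  qed
  have "{b, a} \<notin> E" using ab(4) by (simp add: insert_commute)
  then have "card (N - {a, b}) \<ge> 3" using few[of a "{b}"] ab(1) by blast
  then have cN: "card N = 5" "card (N - {a, b}) = 3" 
    using ab N card_Diff_subset[of "{a, b}" N] by (auto simp: N_def)
  have vN: "{v, x} \<in> E" "{x, v} \<in> E" if "x \<in> N" for x
    using that by (auto simp: N_def nbrs_def insert_commute)
  have aN: "{a, x} \<in> E" "{x, a} \<in> E" "{b, x} \<in> E" "{x, b} \<in> E" if "x \<in> N - {a, b}" for x
    using adj[of a x b] adj[of b x a] ab that by (auto simp: insert_commute)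
  have "\<exists>c\<in>N - {a, b}. \<exists>d\<in>N - {a, b}. c \<noteq> d \<and> {c, d} \<notin> E"
  proof (rule ccontr)
    assume none: "\<not> ?thesis"
    have "clique V E (insert v (insert a (N - {a, b})))"
      unfolding clique_def
    proof (intro conjI ballI impI)
      show "insert v (insert a (N - {a, b})) \<subseteq> V" using NV v ab by auto
      fix x y assume "x \<in> insert v (insert a (N - {a, b}))" "y \<in> insert v (insert a (N - {a, b}))" "x \<noteq> y"
      moreover have "{x, y} \<in> E" if "x \<in> N - {a, b}" "y \<in> N - {a, b}" "x \<noteq> y" for x y
        using none that by blast
      ultimately show "{x, y} \<in> E" using vN aN ab(1) by (elim insertE) simp_all
    qed
    moreover have "card (insert v (insert a M)) = 5" if "M = N - {a, b}" for M
    proof -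
      have "card M = 3" "finite M" "a \<notin> M" "v \<notin> insert a M"
        using that cN(2) finN NV ab(1) by auto
      then show ?thesis by simp
    qed
    ultimately show False using no_K5[OF P] by simp
  qed
  then obtain c d where cd: "c \<in> N - {a, b}" "d \<in> N - {a, b}" "c \<noteq> d" "{c, d} \<notin> E" by blast
  have "card (N - {a, b} - {c, d}) = 1" using cN(2) finN cd by (simp add: card_Diff_subset)
  then obtain e where e: "N - {a, b} - {c, d} = {e}" by (auto simp: card_1_singleton_iff)
  then have eN: "e \<in> N - {a, b}" "e \<noteq> c" "e \<noteq> d" by auto
  have ecd: "{c, e} \<in> E" "{d, e} \<in> E"
    using adj[of c e d] adj[of d e c] cd eN by (auto simp: insert_commute)
  have edges: "{v, a} \<in> E" "{v, b} \<in> E" "{v, d} \<in> E" "{v, e} \<in> E" "{a, d} \<in> E" "{a, e} \<in> E"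
    "{b, d} \<in> E" "{b, e} \<in> E" "{d, e} \<in> E" "{c, b} \<in> E" "{a, c} \<in> E"
    using vN aN ecd ab cd eN by auto
  have vN': "v \<notin> N" using NV by auto
  define F where "F = contract a c E"
  have keep: "{x, y} \<in> F" "{y, x} \<in> F" if "{x, y} \<in> E" "x \<noteq> c" "y \<noteq> c" for x y
  proof -
    show "{x, y} \<in> F"
      unfolding F_def using that edge_ne[OF G that(1)] by (intro contract_unmerged_edge)
    then show "{y, x} \<in> F" by (simp add: insert_commute)
  qed
  have abF: "{b, a} \<in> F"
    unfolding F_def using edges(10) ab(3) cd by (intro contract_merged_edge) (auto simp: insert_commute)
  then have baF: "{a, b} \<in> F" by (simp add: insert_commute)
  have ne: "v \<noteq> a" "v \<noteq> b" "v \<noteq> c" "v \<noteq> d" "v \<noteq> e" "a \<noteq> c" "b \<noteq> c" "d \<noteq> c" "e \<noteq> c"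
     "a \<noteq> d" "a \<noteq> e" "b \<noteq> d" "b \<noteq> e" "d \<noteq> e"
    using vN' ab cd eN by auto
  have "P (V - {c}) F" unfolding F_def using contract[OF P edges(11)] ne by blast
  moreover have "clique (V - {c}) F {v, a, b, d, e}"
    unfolding clique_def
  proof (intro conjI ballI impI)
    show "{v, a, b, d, e} \<subseteq> V - {c}" using NV v ab cd eN ne by auto
    note k = keep[OF edges(1)] keep[OF edges(2)] keep[OF edges(3)] keep[OF edges(4)] keep[OF edges(5)]
      keep[OF edges(6)] keep[OF edges(7)] keep[OF edges(8)] keep[OF edges(9)]
    fix x y assume "x \<in> {v, a, b, d, e}" "y \<in> {v, a, b, d, e}" "x \<noteq> y"
    moreover have "\<forall>x\<in>{v, a, b, d, e}. \<forall>y\<in>{v, a, b, d, e}. x \<noteq> y \<longrightarrow> {x, y} \<in> F"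
      unfolding ball_simps using k ne abF baF by (simp only: simp_thms)
    ultimately show "{x, y} \<in> F" by blast
  qed
  moreover have "card {v, a, b, d, e} = 5" using ne ab(3) by simp
  ultimately show False using no_K5[of "V - {c}" F "{v, a, b, d, e}"] by simp
qed

text \<open>
  The bound of Euler's formula, obtained from the exclusion of the minor alone. In a
  smallest counterexample the number of edges exceeds the bound by exactly one, as an edge
  could be deleted otherwise. Deleting a vertex shows that all degrees are at least 4, and
  contracting an edge shows that its ends have at least three common neighbours. The average
  degree is below 6, so some vertex has degree 4 or 5, which is excluded by
  \<open>no_dense_neighbourhood\<close>.
\<close>

lemma edge_bound:
  assumes "P V E" "3 \<le> card V"
  shows "card E + 6 \<le> 3 * card V"
  using assms
proof (induction "card V + card E" arbitrary: V E rule: less_induct)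
  case less
  note P = less.prems(1)
  note G = graph[OF P]
  have fin: "finite V" "finite E" using G finite_edges by (auto simp: finite_simple_graph_def)
  show ?case
  proof (cases "card V = 3")
    case True
    have "E \<subseteq> {e. e \<subseteq> V \<and> card e = 2}" using G by (auto simp: finite_simple_graph_def)
    then have "card E \<le> card {e. e \<subseteq> V \<and> card e = 2}" using fin by (intro card_mono) auto
    also have "\<dots> = 3" using n_subsets[OF fin(1), of 2] True by (simp add: numeral_eq_Suc)
    finally show ?thesis using True by simp
  next
    case False
    then have V4: "4 \<le> card V" using less.prems by simp
    show ?thesis
    proof (rule ccontr)
      assume "\<not> ?thesis"
      then have big: "3 * card V < card E + 6" by simp
      then have "E \<noteq> {}" using V4 by auto
      then obtain e where e: "e \<in> E" by blast
      have cE: "card (E - {e}) = card E - 1" "card E > 0" 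
        using fin e by (auto simp: card_gt_0_iff)
      have "card V + card (E - {e}) < card V + card E" using cE by linarith
      then have "card (E - {e}) + 6 \<le> 3 * card V"
        using less.hyps[OF _ delete_edge[OF P]] V4 by simp
      then have exact: "card E + 5 = 3 * card V" using big cE by linarith
      have deg4: "4 \<le> card (nbrs E v)" if "v \<in> V" for v
      proof -
        have *: "card (edges_avoiding v E) + card (nbrs E v) = card E"
          by (rule card_edges_avoiding[OF G])
        have cV: "card (V - {v}) = card V - 1" using that by simp
        have "card (V - {v}) + card (edges_avoiding v E) < card V + card E" "3 \<le> card (V - {v})"
          using * cV V4 by linarith+
        then have "card (edges_avoiding v E) + 6 \<le> 3 * card (V - {v})"
          using less.hyps[OF _ delete_vertex[OF P, of v]] by blast
        then show ?thesis using * exact cV V4 by linarith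
      qed
      have common: "3 \<le> card (nbrs E u \<inter> nbrs E v)" if uv: "{u, v} \<in> E" for u v
      proof -
        have "u \<noteq> v" using edge_ne[OF G uv] .
        have vV: "v \<in> V" using uv G by (auto simp: finite_simple_graph_def)
        have *: "card E \<le> card (contract u v E) + 1 + card (nbrs E u \<inter> nbrs E v)"
          by (rule card_contract[OF G uv])
        have cV: "card (V - {v}) = card V - 1" using vV by simp
        have "contract u v E \<subseteq> (`) (merge u v) ` E" by (auto simp: contract_def)
        then have "card (contract u v E) \<le> card E"
          using fin(2) by (meson card_image_le card_mono finite_imageI le_trans)
        then have "card (V - {v}) + card (contract u v E) < card V + card E" "3 \<le> card (V - {v})"
          using cV V4 by linarith+
        then have "card (contract u v E) + 6 \<le> 3 * card (V - {v})"
          using less.hyps[OF _ contract[OF P uv \<open>u \<noteq> v\<close>]] by blast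
        then show ?thesis using * exact cV V4 by linarith
      qed
      have "\<exists>v\<in>V. card (nbrs E v) \<le> 5"
      proof (rule ccontr)
        assume "\<not> ?thesis"
        then have "(\<Sum>v\<in>V. 6) \<le> (\<Sum>v\<in>V. card (nbrs E v))" by (intro sum_mono) force
        then show False using handshake[OF G] exact by simp
      qed
      then obtain v where v: "v \<in> V" "card (nbrs E v) \<le> 5" by blast
      show False
      proof (rule no_dense_neighbourhood[OF P v(1)])
        show "card (nbrs E v) = 4 \<or> card (nbrs E v) = 5" using deg4[OF v(1)] v(2) by linarith
        show "3 \<le> card (nbrs E u \<inter> nbrs E v)" if "u \<in> nbrs E v" for u
          using common[of u v] that by (simp add: nbrs_def)
      qed
    qed
  qed
qed

lemma degree_at_most_5:
  assumes P: "P V E" and "V \<noteq> {}"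
  shows "\<exists>v\<in>V. card (nbrs E v) \<le> 5"
proof (rule ccontr)
  assume "\<not> ?thesis"
  then have big: "6 \<le> card (nbrs E v)" if "v \<in> V" for v using that by force
  note G = graph[OF P]
  have fin: "finite V" using G by (simp add: finite_simple_graph_def)
  obtain v where v: "v \<in> V" using assms(2) by blast
  have "card (nbrs E v) \<le> card (V - {v})" using fin nbrs_subset[OF G] by (intro card_mono) auto
  then have "3 \<le> card V" using big[OF v] fin v by simp
  then have "card E + 6 \<le> 3 * card V" by (rule edge_bound[OF P])
  moreover have "(\<Sum>v\<in>V. 6) \<le> (\<Sum>v\<in>V. card (nbrs E v))" using big by (rule sum_mono)
  then have "card V * 6 \<le> 2 * card E" using handshake[OF G] by simp
  ultimately show False by linarith
qed

theorem five_colourable: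
  assumes "P V E"
  shows "\<exists>c. proper_colouring V E 5 c"
  using degree_at_most_5 by (intro colourable_if_small_degrees[OF _ _ assms]) auto

end

section \<open>Interval models\<close>

text \<open>
  Vertices are assigned intervals \<open>{l v..r v}\<close>, adjacent vertices have
  intersecting intervals, and no point lies in more than \<open>m\<close> of them. A graph
  has such a model if and only if its pathwidth is less than \<open>m\<close>.
\<close>

definition interval_model ::
    "'a set \<Rightarrow> 'a set set \<Rightarrow> nat \<Rightarrow> ('a \<Rightarrow> nat) \<Rightarrow> ('a \<Rightarrow> nat) \<Rightarrow> bool" where
  "interval_model V E m l r \<longleftrightarrow>
     (\<forall>v\<in>V. l v \<le> r v) \<and>
     (\<forall>u\<in>V. \<forall>v\<in>V. {u, v} \<in> E \<longrightarrow> l u \<le> r v) \<and>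
     (\<forall>t. card {v \<in> V. l v \<le> t \<and> t \<le> r v} \<le> m)"

lemma interval_model_subgraph:
  assumes "interval_model V E m l r" "finite V" "V' \<subseteq> V" "E' \<subseteq> E"
  shows "interval_model V' E' m l r"
proof -
  have "card {v \<in> V'. l v \<le> t \<and> t \<le> r v} \<le> m" for t
  proof -
    have "card {v \<in> V'. l v \<le> t \<and> t \<le> r v} \<le> card {v \<in> V. l v \<le> t \<and> t \<le> r v}"
      using assms(2,3) by (intro card_mono) auto
    then show ?thesis using assms(1) unfolding interval_model_def by (meson le_trans)
  qed
  then show ?thesis using assms unfolding interval_model_def by blast
qed

text \<open>
  The contracted vertex receives the union of the two intersecting intervals, which is an
  interval again. A point in the new interval lies in one of the old ones, so no point is
  covered more often than before.
\<close>

lemma interval_model_contract: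
  assumes I: "interval_model V E m l r" and G: "finite_simple_graph V E" and ab: "{a, b} \<in> E"
  shows "\<exists>l r. interval_model (V - {b}) (contract a b E) m l r"
proof -
  define l' where "l' = l(a := min (l a) (l b))"
  define r' where "r' = r(a := max (r a) (r b))"
  have V: "a \<in> V" "b \<in> V" and fin: "finite V" using G ab by (auto simp: finite_simple_graph_def)
  have ne: "a \<noteq> b" by (rule edge_ne[OF G ab])
  have lr: "l v \<le> r v" if "v \<in> V" for v using I that by (simp add: interval_model_def)
  have meet: "l u \<le> r v" if "u \<in> V" "v \<in> V" "{u, v} \<in> E" for u v
    using I that by (simp add: interval_model_def)
  have l': "l' (merge a b v) \<le> l v" and r': "r v \<le> r' (merge a b v)" for v
    by (auto simp: l'_def r'_def merge_def)
  have abm: "l a \<le> r b" "l b \<le> r a" using meet V ab by (auto simp: insert_commute)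
  have "interval_model (V - {b}) (contract a b E) m l' r'"
    unfolding interval_model_def
  proof (intro conjI ballI allI impI)
    fix v assume "v \<in> V - {b}"
    then show "l' v \<le> r' v" using lr[of v] by (auto simp: l'_def r'_def)
  next
    fix u v assume "{u, v} \<in> contract a b E"
    then obtain e where e: "e \<in> E" "{u, v} = merge a b ` e" by (auto simp: contract_def)
    obtain x y where xy: "e = {x, y}" using edge_doubleton[OF G e(1)] by blast
    have "x \<in> V" "y \<in> V" "{x, y} \<in> E" "{y, x} \<in> E"
      using e(1) xy G by (auto simp: finite_simple_graph_def insert_commute)
    then have "l x \<le> r y" "l y \<le> r x" using meet by auto
    moreover have "(u = merge a b x \<and> v = merge a b y) \<or> (u = merge a b y \<and> v = merge a b x)"
      using e(2) xy by (simp add: doubleton_eq_iff)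
    ultimately show "l' u \<le> r' v" using l' r' by (metis le_trans)
  next
    fix t
    have "{v \<in> V - {b}. l' v \<le> t \<and> t \<le> r' v} \<subseteq> merge a b ` {v \<in> V. l v \<le> t \<and> t \<le> r v}"
    proof
      fix v assume v: "v \<in> {v \<in> V - {b}. l' v \<le> t \<and> t \<le> r' v}"
      show "v \<in> merge a b ` {v \<in> V. l v \<le> t \<and> t \<le> r v}"
      proof (cases "v = a")
        case False
        then show ?thesis using v by (intro image_eqI[of _ _ v]) (auto simp: merge_def l'_def r'_def)
      next
        case True
        then have "min (l a) (l b) \<le> t" "t \<le> max (r a) (r b)" using v by (auto simp: l'_def r'_def)
        then have "l a \<le> t \<or> l b \<le> t" "t \<le> r a \<or> t \<le> r b"
          by (simp_all add: min_le_iff_disj le_max_iff_disj)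
        then consider "l a \<le> t" "t \<le> r a" | "l b \<le> t" "t \<le> r b"
          using abm by linarith
        then show ?thesis
        proof cases
          case 1 then show ?thesis using V True ne by (intro image_eqI[of _ _ a]) (auto simp: merge_def)
        next
          case 2 then show ?thesis using V True by (intro image_eqI[of _ _ b]) (auto simp: merge_def)
        qed
      qed
    qed
    then have "card {v \<in> V - {b}. l' v \<le> t \<and> t \<le> r' v} \<le> card {v \<in> V. l v \<le> t \<and> t \<le> r v}"
      using fin by (intro surj_card_le) auto
    also have "\<dots> \<le> m" using I by (simp add: interval_model_def)
    finally show "card {v \<in> V - {b}. l' v \<le> t \<and> t \<le> r' v} \<le> m" .
  qed
  then show ?thesis by blast
qed

text \<open>
  For the vertex whose interval ends first, the intervals of all neighbours contain that end
  point.
\<close>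

lemma interval_model_low_degree:
  assumes I: "interval_model V E (Suc k) l r" and G: "finite_simple_graph V E" and "V \<noteq> {}"
  shows "\<exists>v\<in>V. card (nbrs E v) \<le> k"
proof -
  have fin: "finite V" using G by (simp add: finite_simple_graph_def)
  obtain v where v: "v \<in> V" "\<And>u. u \<in> V \<Longrightarrow> r v \<le> r u"
    using arg_min_if_finite[OF fin assms(3), of r] by (metis not_le)
  have N: "nbrs E v \<subseteq> V - {v}" "finite (nbrs E v)" using nbrs_subset[OF G] nbrs_finite[OF G] by auto
  have "insert v (nbrs E v) \<subseteq> {u \<in> V. l u \<le> r v \<and> r v \<le> r u}"
    using I v N by (auto simp: nbrs_def interval_model_def)
  then have "card (insert v (nbrs E v)) \<le> card {u \<in> V. l u \<le> r v \<and> r v \<le> r u}"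
    using fin by (intro card_mono) auto
  also have "\<dots> \<le> Suc k" using I by (simp add: interval_model_def)
  finally have "card (nbrs E v) \<le> k" using N by (subst (asm) card_insert_disjoint) auto
  then show ?thesis using v(1) by blast
qed

lemma finite_simple_graph_delete_vertex:
  "finite_simple_graph V E \<Longrightarrow> finite_simple_graph (V - {v}) (edges_avoiding v E)"
  by (auto simp: finite_simple_graph_def edges_avoiding_def)

lemma interval_model_colourable:
  assumes "interval_model V E (Suc k) l r" "finite_simple_graph V E"
  shows "\<exists>c. proper_colouring V E (Suc k) c"
  using assms
proof (induction "card V" arbitrary: V E rule: less_induct)
  case less
  have fin: "finite V" using less.prems(2) by (simp add: finite_simple_graph_def)
  show ?case
  proof (cases "V = {}")
    case True then show ?thesis by (intro exI[of _ "\<lambda>_. 0"]) (simp add: proper_colouring_def)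
  next
    case False
    then obtain v where v: "v \<in> V" "card (nbrs E v) \<le> k"
      using interval_model_low_degree less.prems by blast
    have "card (V - {v}) < card V" using fin v(1) by (rule card_Diff1_less)
    moreover have "interval_model (V - {v}) (edges_avoiding v E) (Suc k) l r"
      using less.prems(1) fin by (rule interval_model_subgraph) (auto simp: edges_avoiding_def)
    ultimately obtain c where c: "proper_colouring (V - {v}) (edges_avoiding v E) (Suc k) c"
      using less.hyps finite_simple_graph_delete_vertex[OF less.prems(2)] by blast
    have "card (c ` nbrs E v) < Suc k"
      using card_image_le[OF nbrs_finite[OF less.prems(2)], of c v] v(2) by linarith
    then show ?thesis by (rule extend_colouring[OF less.prems(2) c])
  qed
qed

section \<open>Zero forcing sets give interval models\<close>

text \<open>
  Forcing is followed together with a set \<open>A\<close> of active vertices among the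
  black vertices \<open>W\<close>, which contains all black vertices with a white neighbour.
  Initially all black vertices are active. When \<open>u\<close> forces \<open>v\<close>,
  the vertex \<open>u\<close> has no white neighbour left and \<open>v\<close> takes its
  place, so the number of active vertices never grows, and every black neighbour of
  \<open>v\<close> is active at that moment.
\<close>

lemma zero_forcing_induct:
  assumes G: "finite_simple_graph V E" and B: "zero_forcing_set V E B"
    and base: "Q B B"
    and step: "\<And>A W u v. \<lbrakk>Q A W; A \<subseteq> W; W \<subseteq> V; card A \<le> card B; u \<in> A; v \<in> V - W; {u, v} \<in> E;
        \<And>x. x \<in> W \<Longrightarrow> {x, v} \<in> E \<Longrightarrow> x \<in> A\<rbrakk> \<Longrightarrow> Q (insert v (A - {u})) (insert v W)"
  shows "\<exists>A. Q A V"
proof -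
  have fin: "finite V" using G by (simp add: finite_simple_graph_def)
  have BV: "B \<subseteq> V" and steps: "(colour_change V E)\<^sup>*\<^sup>* B V"
    using B by (auto simp: zero_forcing_set_def)
  have "\<exists>A. Q A W \<and> A \<subseteq> W \<and> W \<subseteq> V \<and> card A \<le> card B \<and>
    (\<forall>x\<in>W - A. \<forall>y\<in>V - W. {x, y} \<notin> E)" if "(colour_change V E)\<^sup>*\<^sup>* B W" for W
    using that
  proof (induction rule: rtranclp_induct)
    case base
    then show ?case using \<open>Q B B\<close> BV by (intro exI[of _ B]) auto
  next
    case (step W W')
    then obtain A where A: "Q A W" "A \<subseteq> W" "W \<subseteq> V" "card A \<le> card B"
      and dead: "\<And>x y. \<lbrakk>x \<in> W - A; y \<in> V - W\<rbrakk> \<Longrightarrow> {x, y} \<notin> E" by blast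
    obtain u v where f: "forces V E W u v" "W' = insert v W"
      using step.hyps(2) unfolding colour_change_def by blast
    then have uW: "u \<in> W" and white: "{w \<in> V. {u, w} \<in> E \<and> w \<notin> W} = {v}" by (auto simp: forces_def)
    then have v: "v \<in> V - W" "{u, v} \<in> E" by auto
    have uA: "u \<in> A" using dead[of u v] uW v by blast
    have actA: "x \<in> A" if "x \<in> W" "{x, v} \<in> E" for x using dead[of x v] that v by blast
    have "Q (insert v (A - {u})) (insert v W)"
      using assms(4)[OF A uA v] actA by blast
    moreover have "insert v (A - {u}) \<subseteq> insert v W" "insert v W \<subseteq> V" using A v by auto
    moreover have "card (insert v (A - {u})) \<le> card B"
    proof -
      have finA: "finite A" using A fin by (meson finite_subset)
      have "card (insert v (A - {u})) \<le> Suc (card (A - {u}))"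
        using finA by (intro card_insert_le_m1) auto
      also have "\<dots> = card A" using card_Suc_Diff1[OF finA uA] .
      finally show ?thesis using A(4) by simp
    qed
    moreover have "{x, y} \<notin> E" if x: "x \<in> insert v W - insert v (A - {u})" and y: "y \<in> V - insert v W" for x y
    proof (cases "x = u")
      case True
      then show ?thesis using white y by blast
    next
      case False
      then show ?thesis using dead[of x y] x y by blast
    qed
    ultimately show ?case unfolding f(2) by blast
  qed
  then show ?thesis using steps by blast
qed

text \<open>
  The interval of a vertex is the period of its activity. When \<open>u\<close> forces
  \<open>v\<close>, both are counted, which accounts for the additional one. In the
  induction the intervals of the active vertices extend to the present time
  \<open>n\<close>.
\<close>

lemma zero_forcing_interval_model:
  assumes G: "finite_simple_graph V E" and B: "zero_forcing_set V E B"
  shows "\<exists>l r. interval_model V E (Suc (card B)) l r"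
proof -
  have fin: "finite V" using G by (simp add: finite_simple_graph_def)
  define Q where "Q = (\<lambda>A W. \<exists>l r n. (\<forall>x\<in>W. l x \<le> r x \<and> r x \<le> n) \<and> (\<forall>x\<in>A. r x = n) \<and>
     (\<forall>x\<in>W. \<forall>y\<in>W. {x, y} \<in> E \<longrightarrow> l x \<le> r y) \<and>
     (\<forall>t::nat. card {x \<in> W. l x \<le> t \<and> t \<le> r x} \<le> Suc (card B)))"
  have "\<exists>A. Q A V"
  proof (rule zero_forcing_induct[OF G B])
    have "finite B" using B fin by (meson finite_subset zero_forcing_set_def)
    then have "card {x \<in> B. (0::nat) \<le> t \<and> t \<le> 0} \<le> Suc (card B)" for t
      by (intro le_SucI card_mono) auto
    then show "Q B B"
      unfolding Q_def by (intro exI[of _ "\<lambda>_. 0"] exI[of _ 0]) auto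
  next
    fix A W u v
    assume "Q A W" and A: "A \<subseteq> W" "W \<subseteq> V" "card A \<le> card B" and uv: "u \<in> A" "v \<in> V - W" "{u, v} \<in> E"
      and act: "\<And>x. x \<in> W \<Longrightarrow> {x, v} \<in> E \<Longrightarrow> x \<in> A"
    from \<open>Q A W\<close> obtain l r :: "'a \<Rightarrow> nat" and n where lr: "\<And>x. x \<in> W \<Longrightarrow> l x \<le> r x \<and> r x \<le> n"
      and rA: "\<And>x. x \<in> A \<Longrightarrow> r x = n"
      and meet: "\<And>x y. \<lbrakk>x \<in> W; y \<in> W; {x, y} \<in> E\<rbrakk> \<Longrightarrow> l x \<le> r y"
      and cover: "\<And>t. card {x \<in> W. l x \<le> t \<and> t \<le> r x} \<le> Suc (card B)"
      unfolding Q_def by blast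
    have finW: "finite W" "finite A" using A fin by (meson finite_subset)+
    define l' where "l' = l(v := Suc n)"
    define r' where "r' = (\<lambda>x. if x \<in> insert v A then Suc n else r x)"
    have l'W: "l' x = l x" if "x \<in> W" for x using that uv(2) by (auto simp: l'_def)
    have r'W: "r x \<le> r' x" if "x \<in> W" for x using lr[OF that] by (auto simp: r'_def)
    show "Q (insert v (A - {u})) (insert v W)"
      unfolding Q_def
    proof (rule exI[of _ l'], rule exI[of _ r'], rule exI[of _ "Suc n"], intro conjI ballI allI impI)
      fix x assume x: "x \<in> insert v W"
      show "l' x \<le> r' x"
        using x lr[of x] r'W[of x] l'W[of x] by (cases "x = v") (auto simp: l'_def r'_def)
      show "r' x \<le> Suc n" using x lr[of x] by (auto simp: r'_def)
    next
      fix x assume "x \<in> insert v (A - {u})" then show "r' x = Suc n" by (auto simp: r'_def)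
    next
      fix x y assume xy: "x \<in> insert v W" "y \<in> insert v W" "{x, y} \<in> E"
      have "x \<noteq> y" using edge_ne[OF G xy(3)] .
      then consider "x = v" "y \<in> W" | "y = v" "x \<in> W" | "x \<in> W" "y \<in> W" using xy by blast
      then show "l' x \<le> r' y"
      proof cases
        case 1
        then have "y \<in> A" using act[of y] xy(3) by (simp add: insert_commute)
        then show ?thesis using 1 by (simp add: l'_def r'_def)
      next
        case 2
        then show ?thesis using lr[of x] l'W[of x] by (auto simp: r'_def)
      next
        case 3
        then show ?thesis using meet[of x y] xy(3) l'W[of x] r'W[of y] by linarith
      qed
    next
      fix t
      show "card {x \<in> insert v W. l' x \<le> t \<and> t \<le> r' x} \<le> Suc (card B)"
      proof (cases "t \<le> n")
        case True
        have "{x \<in> insert v W. l' x \<le> t \<and> t \<le> r' x} \<subseteq> {x \<in> W. l x \<le> t \<and> t \<le> r x}"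
          using True rA l'W by (auto simp: l'_def r'_def split: if_splits)
        then have "card {x \<in> insert v W. l' x \<le> t \<and> t \<le> r' x} \<le> card {x \<in> W. l x \<le> t \<and> t \<le> r x}"
          using finW by (intro card_mono) auto
        then show ?thesis using cover[of t] by linarith
      next
        case False
        \<comment> \<open>From the new time on, only the active vertices, including \<open>u\<close>, and
          \<open>v\<close> are counted.\<close>
        have "{x \<in> insert v W. l' x \<le> t \<and> t \<le> r' x} \<subseteq> insert v A"
        proof
          fix x assume "x \<in> {x \<in> insert v W. l' x \<le> t \<and> t \<le> r' x}"
          then show "x \<in> insert v A" using False lr[of x] by (auto simp: r'_def split: if_splits)
        qed
        then have "card {x \<in> insert v W. l' x \<le> t \<and> t \<le> r' x} \<le> card (insert v A)"
          using finW by (intro card_mono) auto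
        also have "\<dots> \<le> Suc (card A)" using finW by (intro card_insert_le_m1) auto
        finally show ?thesis using A(3) by linarith
      qed
    qed
  qed
  then obtain A where "Q A V" by blast
  then show ?thesis unfolding Q_def interval_model_def by blast
qed

section \<open>Colouring triangle-free graphs along a zero forcing process\<close>

definition independent :: "'a set set \<Rightarrow> 'a set \<Rightarrow> bool" where
  "independent E S \<longleftrightarrow> (\<forall>x\<in>S. \<forall>y\<in>S. {x, y} \<notin> E)"

text \<open>
  A new vertex is adjacent to \<open>N\<close> and not to \<open>R\<close>. Its colour must
  be absent from \<open>N\<close>, and no independent set made of the new vertex and a part
  of \<open>R\<close> may show all \<open>q\<close> colours. The second condition concerns
  only the sets \<open>T\<close> in \<open>full\<close>, which show \<open>q - 1\<close>
  colours, and it says that the new colour occurs in each of them; the colours in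
  \<open>M\<close> violate it. It remains to see that \<open>M\<close> and the colours of
  \<open>N\<close> do not exhaust all colours. If \<open>R\<close> does not show all
  colours, then all \<open>T\<close> show the colours of \<open>R\<close>, and
  \<open>M\<close> consists of one colour. Otherwise \<open>R\<close> has \<open>q\<close>
  vertices of different colours. It is then not independent, and each \<open>T\<close> is
  \<open>R\<close> without one end of a fixed edge of \<open>R\<close>, so \<open>M\<close>
  has at most two elements. In both cases the bound on \<open>card N + card R\<close>
  suffices.
\<close>

lemma colour_free_and_frugal:
  fixes c :: "'a \<Rightarrow> nat"
  assumes fin: "finite N" "finite R" and c: "c ` (N \<union> R) \<subseteq> {..<q}" and q: "2 \<le> q"
    and N: "card (c ` N) < q"
    and frugal: "\<And>S. \<lbrakk>S \<subseteq> R; independent E S\<rbrakk> \<Longrightarrow> card (c ` S) < q"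
    and R: "card R \<le> q" and NR: "card N + card R \<le> 2 * q - 3"
  shows "\<exists>x<q. x \<notin> c ` N \<and> (\<forall>T\<subseteq>R. independent E T \<longrightarrow> card (insert x (c ` T)) < q)"
proof -
  define full where "full = {T. T \<subseteq> R \<and> independent E T \<and> card (c ` T) = q - 1}"
  define M where "M = {x. x < q \<and> (\<exists>T\<in>full. x \<notin> c ` T)}"
  have finM: "finite M" by (auto simp: M_def)
  have finT: "finite (c ` T)" if "T \<subseteq> R" for T using fin(2) that by (meson finite_imageI finite_subset)
  have cT: "card (c ` T) \<le> card T" if "T \<subseteq> R" for T
    using fin(2) that by (meson card_image_le finite_subset)
  have "card M + card (c ` N) < q"
  proof (cases "full = {}")
    case True
    then show ?thesis using N by (simp add: M_def)
  next
    case False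
    then obtain T0 where T0: "T0 \<in> full" by blast
    have cN: "card (c ` N) \<le> card N" by (rule card_image_le[OF fin(1)])
    have qR: "q - 1 \<le> card R"
      using T0 cT[of T0] card_mono[OF fin(2), of T0] by (auto simp: full_def)
    have one: "card M \<le> 1" if small: "card (c ` R) < q"
    proof -
      have eq: "c ` T = c ` R" if T: "T \<in> full" for T
        using T small finT[of R] by (intro card_seteq) (auto simp: full_def)
      have "M \<subseteq> {..<q} - c ` R" using eq by (auto simp: M_def)
      then have "card M \<le> card ({..<q} - c ` R)" by (intro card_mono) auto
      also have "\<dots> = q - card (c ` R)" using c finT[of R] by (subst card_Diff_subset) auto
      also have "card (c ` R) = q - 1" using eq[OF T0] T0 by (simp add: full_def)
      finally show ?thesis by linarith
    qed
    show ?thesis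
    proof (cases "card (c ` R) < q")
      case True
      have "card N + card R \<le> 2 * q - 3" by (rule NR)
      then show ?thesis using one[OF True] qR cN q by linarith
    next
      case rainbow: False
      have Rq: "card R = q" "card (c ` R) = q" using rainbow R cT[of R] by auto
      have inj: "inj_on c R" using Rq fin(2) by (simp add: eq_card_imp_inj_on)
      have "\<not> independent E R" using frugal[of R] Rq by auto
      then obtain y z where yz: "y \<in> R" "z \<in> R" "{y, z} \<in> E" by (auto simp: independent_def)
      have "c ` R = {..<q}" using c Rq by (intro card_seteq) auto
      have "M \<subseteq> {c y, c z}"
      proof
        fix x assume "x \<in> M"
        then obtain T where T: "T \<subseteq> R" "independent E T" "card (c ` T) = q - 1" "x \<notin> c ` T" "x < q"
          by (auto simp: M_def full_def)
        have "y \<notin> T \<or> z \<notin> T" using T(2) yz(3) by (auto simp: independent_def)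
        then obtain w where w: "w \<in> {y, z}" "w \<notin> T" by blast
        then have wR: "w \<in> R" using yz by auto
        have "T \<subseteq> R - {w}" using T(1) w(2) by blast
        moreover have "card (R - {w}) \<le> card T" using cT[OF T(1)] T(3) Rq wR fin(2) by simp
        ultimately have "T = R - {w}" using fin(2) by (intro card_seteq) auto
        moreover have "x \<in> c ` R" using T(5) \<open>c ` R = {..<q}\<close> by simp
        ultimately have "x = c w" using T(4) by auto
        then show "x \<in> {c y, c z}" using w(1) by auto
      qed
      then have "card M \<le> card {c y, c z}" by (intro card_mono) auto
      also have "\<dots> \<le> 2" by (simp add: card_insert_if)
      finally show ?thesis using NR Rq cN q by linarith
    qed
  qed
  then have "card (M \<union> c ` N) < card {..<q}" using card_Un_le[of M "c ` N"] by simp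
  then have "\<not> {..<q} \<subseteq> M \<union> c ` N"
    using card_mono[of "M \<union> c ` N" "{..<q}"] finM fin(1) by auto
  then obtain x where x: "x < q" "x \<notin> M" "x \<notin> c ` N" by auto
  have "card (insert x (c ` T)) < q" if T: "T \<subseteq> R" "independent E T" for T
  proof (cases "T \<in> full")
    case True
    then have "x \<in> c ` T" using x by (auto simp: M_def)
    then show ?thesis using frugal[OF T] by (simp add: insert_absorb)
  next
    case False
    then have "card (c ` T) < q - 1" using frugal[OF T] T by (auto simp: full_def)
    moreover have "card (insert x (c ` T)) \<le> Suc (card (c ` T))"
      using finT[OF T(1)] by (simp add: card_insert_if)
    ultimately show ?thesis by linarith
  qed
  then show ?thesis using x by blast
qed

text \<open>
  A colouring of the black vertices \<open>W\<close> in which independent sets of active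
  vertices leave a colour unused. The neighbourhood of a new vertex is such a set in a
  triangle-free graph, so the colouring can always be extended; keeping the invariant is the
  harder half.
\<close>

definition frugal_colouring ::
    "'a set set \<Rightarrow> nat \<Rightarrow> 'a set \<Rightarrow> 'a set \<Rightarrow> ('a \<Rightarrow> nat) \<Rightarrow> bool" where
  "frugal_colouring E q A W c \<longleftrightarrow> proper_colouring W E q c \<and>
     (\<forall>S\<subseteq>A. independent E S \<longrightarrow> card (c ` S) < q)"

definition triangle_free :: "'a set set \<Rightarrow> bool" where
  "triangle_free E \<longleftrightarrow> (\<forall>x y z. \<not> ({x, y} \<in> E \<and> {y, z} \<in> E \<and> {x, z} \<in> E))"

lemma extend_frugal_colouring:
  assumes G: "finite_simple_graph V E"
    and tf: "triangle_free E"
    and c: "frugal_colouring E q A W c" and A: "A \<subseteq> W" "W \<subseteq> V" "v \<in> V - W"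
    and NA: "nbrs E v \<inter> W \<subseteq> A" and A': "A' \<subseteq> A"
    and R: "card (A' - nbrs E v) \<le> q"
    and NR: "card (nbrs E v \<inter> W) + card (A' - nbrs E v) \<le> 2 * q - 3" and q: "2 \<le> q"
  shows "\<exists>c. frugal_colouring E q (insert v A') (insert v W) c"
proof -
  have finW: "finite W" using G A(2) by (meson finite_simple_graph_def finite_subset)
  have finA': "finite A'" using finW A(1) A' by (meson finite_subset)
  define N where "N = nbrs E v \<inter> W"
  define R where "R = A' - nbrs E v"
  have sub: "N \<subseteq> A" "R \<subseteq> A" "N \<subseteq> W" "R \<subseteq> W" "finite N" "finite R"
    using NA A A' finW finA' by (auto simp: N_def R_def)
  have cW: "c w < q" if "w \<in> W" for w using c that by (simp add: frugal_colouring_def proper_colouring_def)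
  have fr: "card (c ` S) < q" if "S \<subseteq> A" "independent E S" for S
    using c that by (simp add: frugal_colouring_def)
  have "independent E N"
    using tf unfolding independent_def N_def nbrs_def triangle_free_def by (auto simp: insert_commute)
  then have "\<exists>x<q. x \<notin> c ` N \<and> (\<forall>T\<subseteq>R. independent E T \<longrightarrow> card (insert x (c ` T)) < q)"
    using sub fr cW R NR q by (intro colour_free_and_frugal) (auto simp: N_def R_def)
  then obtain x where x: "x < q" "x \<notin> c ` N"
    and xT: "\<And>T. \<lbrakk>T \<subseteq> R; independent E T\<rbrakk> \<Longrightarrow> card (insert x (c ` T)) < q" by blast
  have vW: "v \<notin> W" using A(3) by blast
  have "frugal_colouring E q (insert v A') (insert v W) (c(v := x))"
    unfolding frugal_colouring_def proper_colouring_def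
  proof (intro conjI ballI allI impI)
    fix w assume "w \<in> insert v W" then show "(c(v := x)) w < q" using cW x(1) by auto
  next
    fix a b assume ab: "a \<in> insert v W" "b \<in> insert v W" "{a, b} \<in> E"
    have "a \<noteq> b" using edge_ne[OF G ab(3)] .
    then consider "a = v" "b \<in> W" | "b = v" "a \<in> W" | "a \<in> W" "b \<in> W" using ab by blast
    then show "(c(v := x)) a \<noteq> (c(v := x)) b"
    proof cases
      case 1
      then have "b \<in> N" using ab(3) by (simp add: N_def nbrs_def insert_commute)
      then show ?thesis using x(2) 1 vW by auto
    next
      case 2
      then have "a \<in> N" using ab(3) by (simp add: N_def nbrs_def)
      then show ?thesis using x(2) 2 vW by auto
    next
      case 3
      then have "c a \<noteq> c b" using c ab(3) by (simp add: frugal_colouring_def proper_colouring_def)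
      then show ?thesis using 3 vW by auto
    qed
  next
    fix S assume S: "S \<subseteq> insert v A'" "independent E S"
    have ST: "(c(v := x)) ` (S - {v}) = c ` (S - {v})" by auto
    have ind: "independent E (S - {v})" using S(2) by (auto simp: independent_def)
    show "card ((c(v := x)) ` S) < q"
    proof (cases "v \<in> S")
      case True
      then have "S - {v} \<subseteq> R"
        using S by (auto simp: R_def nbrs_def independent_def)
      then have "card (insert x (c ` (S - {v}))) < q" using xT ind by blast
      moreover have "(c(v := x)) ` S = insert x (c ` (S - {v}))"
      proof -
        have "(c(v := x)) ` S = (c(v := x)) ` (insert v (S - {v}))" using True by (simp add: insert_absorb)
        also have "\<dots> = insert x (c ` (S - {v}))" unfolding image_insert ST by simp
        finally show ?thesis .
      qed
      ultimately show ?thesis by simp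
    next
      case False
      then have "S - {v} = S" "S \<subseteq> A" using S(1) A' by auto
      then show ?thesis using fr[of S] S(2) ST by simp
    qed
  qed
  then show ?thesis by blast
qed

text \<open>
  The initial black vertices are coloured one by one, all of them active, and then the
  forcing process is followed. The bound \<open>q \<le> 4\<close> gives \<open>2 * q - 4
  \<le> q\<close>, so the active vertices not adjacent to a new one number at most
  \<open>q\<close>.
\<close>

lemma triangle_free_zero_forcing_colourable:
  assumes G: "finite_simple_graph V E" and B: "zero_forcing_set V E B"
    and tf: "triangle_free E"
    and q: "card B \<le> 2 * q - 3" "2 \<le> q" "q \<le> 4"
  shows "\<exists>c. proper_colouring V E q c"
proof -
  have finV: "finite V" and BV: "B \<subseteq> V" using G B by (auto simp: finite_simple_graph_def zero_forcing_set_def)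
  have finB: "finite B" using finV BV by (rule finite_subset[rotated])
  have "\<exists>c. frugal_colouring E q S S c" if "finite S" "S \<subseteq> B" for S
    using that
  proof (induction S)
    case empty
    show ?case using q by (intro exI[of _ "\<lambda>_. 0"]) (auto simp: frugal_colouring_def proper_colouring_def)
  next
    case (insert v S)
    then obtain c where c: "frugal_colouring E q S S c" by auto
    have "card (insert v S) \<le> card B" using insert.prems finB by (intro card_mono)
    then have cS: "card S + 1 \<le> 2 * q - 3" using insert.hyps q by simp
    have split: "card (nbrs E v \<inter> S) + card (S - nbrs E v) = card S"
      using insert.hyps(1) by (metis Int_commute card_Int_Diff)
    show ?case
      by (rule extend_frugal_colouring[OF G tf c]) 
        (use insert BV split cS q in auto)
  qed
  then have "\<exists>c. frugal_colouring E q B B c" using finB by blast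
  then have "\<exists>A. \<exists>c. frugal_colouring E q A V c"
  proof (rule zero_forcing_induct[OF G B])
    fix A W u v
    assume "\<exists>c. frugal_colouring E q A W c" and A: "A \<subseteq> W" "W \<subseteq> V" "card A \<le> card B"
      and uv: "u \<in> A" "v \<in> V - W" "{u, v} \<in> E" and act: "\<And>x. x \<in> W \<Longrightarrow> {x, v} \<in> E \<Longrightarrow> x \<in> A"
    then obtain c where c: "frugal_colouring E q A W c" by blast
    have finA: "finite A" using A finV by (meson finite_subset)
    let ?N = "nbrs E v \<inter> W" and ?R = "A - {u} - nbrs E v"
    have uN: "u \<in> nbrs E v" using uv(3) by (simp add: nbrs_def)
    have NA: "?N \<subseteq> A" using act by (auto simp: nbrs_def)
    have "card ?R \<le> card (A - {u})" using finA by (intro card_mono) auto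
    then have R: "card ?R \<le> 2 * q - 4" using A(3) q(1) uv(1) finA by simp
    have "card ?N + card ?R = card (?N \<union> ?R)"
      using finA NA by (intro card_Un_disjoint[symmetric]) (auto intro: finite_subset)
    also have "\<dots> \<le> card A" using finA NA by (intro card_mono) auto
    finally have NR: "card ?N + card ?R \<le> 2 * q - 3" using A(3) q(1) by linarith
    show "\<exists>c. frugal_colouring E q (insert v (A - {u})) (insert v W) c"
      by (rule extend_frugal_colouring[OF G tf c A(1,2) uv(2) NA _ _ NR])
        (use R q in auto)
  qed
  then show ?thesis unfolding frugal_colouring_def by blast
qed

section \<open>The bound for planar graphs\<close>

definition thick_planar :: "'a set \<Rightarrow> 'a set set \<Rightarrow> bool" where
  "thick_planar V E \<longleftrightarrow> finite_simple_graph V E \<and> (\<exists>X L. thick_drawing V E X L)"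

lemma K5_minor_free_thick_planar: "K5_minor_free_class thick_planar"
proof
  fix V :: "'a set" and E assume P: "thick_planar V E"
  then obtain X L where G: "finite_simple_graph V E" and D: "thick_drawing V E X L"
    by (auto simp: thick_planar_def)
  show "finite_simple_graph V E" by (rule G)
  show "thick_planar V' E'" if "V' \<subseteq> V" "E' \<subseteq> E" "\<And>e. e \<in> E' \<Longrightarrow> e \<subseteq> V'" for V' E'
  proof -
    have "finite_simple_graph V' E'"
      using G that by (auto simp: finite_simple_graph_def intro: finite_subset)
    then show ?thesis using thick_drawing_subgraph[OF D that] by (auto simp: thick_planar_def)
  qed
  show "thick_planar (V - {b}) (contract a b E)" if ab: "{a, b} \<in> E" "a \<noteq> b" for a b
  proof -
    have "a \<in> V" using ab G by (auto simp: finite_simple_graph_def)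
    then show ?thesis
      using finite_simple_graph_contract[OF G _ ab(2)] thick_drawing_contract[OF D G ab]
      by (auto simp: thick_planar_def)
  qed
  show "card K \<noteq> 5" if "clique V E K" for K
    using thick_drawing_no_K5[OF D that] by blast
qed

lemma K5_minor_free_interval_model:
  "K5_minor_free_class (\<lambda>V E. thick_planar V E \<and> (\<exists>l r. interval_model V E m l r))"
proof -
  interpret thick: K5_minor_free_class thick_planar by (rule K5_minor_free_thick_planar)
  show ?thesis
  proof
    fix V :: "'a set" and E assume "thick_planar V E \<and> (\<exists>l r. interval_model V E m l r)"
    then obtain l r where P: "thick_planar V E" and I: "interval_model V E m l r" by blast
    have G: "finite_simple_graph V E" by (rule thick.graph[OF P])
    then have fin: "finite V" by (simp add: finite_simple_graph_def)
    show "finite_simple_graph V E" by (rule G)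
    show "thick_planar V' E' \<and> (\<exists>l r. interval_model V' E' m l r)"
      if "V' \<subseteq> V" "E' \<subseteq> E" "\<And>e. e \<in> E' \<Longrightarrow> e \<subseteq> V'" for V' E'
      using thick.subgraph[OF P that] interval_model_subgraph[OF I fin that(1,2)] by blast
    show "thick_planar (V - {b}) (contract a b E) \<and> (\<exists>l r. interval_model (V - {b}) (contract a b E) m l r)"
      if "{a, b} \<in> E" "a \<noteq> b" for a b
      using thick.contract[OF P that] interval_model_contract[OF I G that(1)] by blast
    show "card K \<noteq> 5" if "clique V E K" for K by (rule thick.no_K5[OF P that])
  qed
qed

lemma chromatic_number_le: "proper_colouring V E k c \<Longrightarrow> chromatic_number V E \<le> k"
  unfolding chromatic_number_def by (rule Least_le) blast

lemma card_le_clique_number: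
  assumes "finite_simple_graph V E" "clique V E K"
  shows "card K \<le> clique_number V E"
proof -
  have "{K. clique V E K} \<subseteq> Pow V" by (auto simp: clique_def)
  then have "finite {K. clique V E K}"
    using assms(1) by (meson finite_Pow_iff finite_simple_graph_def finite_subset)
  then show ?thesis unfolding clique_number_def using assms(2) by (intro Max_ge) auto
qed

theorem theorem14:
  fixes V :: "'a set" and E :: "'a set set"
  assumes "finite_simple_graph V E"
    and "planar V E"
  shows "int (chromatic_number V E)
    \<le> \<lceil>(real (clique_number V E) + real (zero_forcing_number V E) + 1) / 2\<rceil>"
proof -
  note G = assms(1)
  define chi \<omega> Z where "chi = chromatic_number V E" and "\<omega> = clique_number V E"
    and "Z = zero_forcing_number V E"
  have "zero_forcing_set V E V" by (simp add: zero_forcing_set_def)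
  then have "\<exists>n. \<exists>B. zero_forcing_set V E B \<and> card B = n" by blast
  then have "\<exists>B. zero_forcing_set V E B \<and> card B = Z"
    unfolding Z_def zero_forcing_number_def by (rule LeastI_ex)
  then obtain B where B: "zero_forcing_set V E B" "card B = Z" by blast
  obtain l r where I: "interval_model V E (Suc Z) l r"
    using zero_forcing_interval_model[OF G B(1)] B(2) by blast
  have P: "thick_planar V E"
    using planar_imp_thick_drawing[OF assms] G by (simp add: thick_planar_def)
  have five: "chi \<le> 5"
    using K5_minor_free_class.five_colourable[OF K5_minor_free_thick_planar P] chromatic_number_le
    unfolding chi_def by blast
  have greedy: "chi \<le> Z + 1"
    using interval_model_colourable[OF I G] chromatic_number_le unfolding chi_def by fastforce
  \<comment> \<open>Width 5 gives a vertex of degree at most 4 in every contraction of the graph.\<close>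
  have four: "chi \<le> 4" if "Z = 4"
  proof -
    interpret K5_minor_free_class "\<lambda>V E. thick_planar V E \<and> (\<exists>l r. interval_model V E (Suc 4) l r)"
      by (rule K5_minor_free_interval_model)
    have "\<exists>c. proper_colouring V E 4 c"
    proof (rule colourable_if_small_degrees)
      show "thick_planar V E \<and> (\<exists>l r. interval_model V E (Suc 4) l r)" using P I that by blast
      show "\<exists>v\<in>V. card (nbrs E v) \<le> 4"
        if "thick_planar V E \<and> (\<exists>l r. interval_model V E (Suc 4) l r)" "V \<noteq> {}" for V and E :: "'a set set"
        using that interval_model_low_degree[of V E 4] by (auto simp: thick_planar_def)
    qed simp
    then show ?thesis using chromatic_number_le unfolding chi_def by blast
  qed
  have edge: "2 \<le> \<omega>" if "{x, y} \<in> E" for x y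
  proof -
    have "x \<noteq> y" by (rule edge_ne[OF G that])
    moreover have "clique V E {x, y}"
      using that G by (auto simp: clique_def finite_simple_graph_def insert_commute)
    ultimately show ?thesis using card_le_clique_number[OF G] unfolding \<omega>_def by fastforce
  qed
  have edgeless: "chi \<le> 1" if "\<omega> < 2"
  proof -
    have "proper_colouring V E 1 (\<lambda>_. 0)" using edge that by (fastforce simp: proper_colouring_def)
    then show ?thesis using chromatic_number_le unfolding chi_def by blast
  qed
  have triangle: "3 \<le> \<omega>" if "{x, y} \<in> E" "{y, z} \<in> E" "{x, z} \<in> E" for x y z
  proof -
    have "card {x, y, z} = 3" using that edge_ne[OF G] by simp
    moreover have "clique V E {x, y, z}"
      using that G by (auto simp: clique_def finite_simple_graph_def insert_commute)
    ultimately show ?thesis using card_le_clique_number[OF G] unfolding \<omega>_def by fastforce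
  qed
  have triangle_free: "chi \<le> q" if "\<omega> < 3" "Z \<le> 2 * q - 3" "2 \<le> q" "q \<le> 4" for q
  proof -
    have "\<exists>c. proper_colouring V E q c"
      by (rule triangle_free_zero_forcing_colourable[OF G B(1)]) (use triangle that B(2) in \<open>fastforce simp: triangle_free_def\<close>)+
    then show ?thesis using chromatic_number_le unfolding chi_def by blast
  qed
  \<comment> \<open>If \<open>chi\<close> is 5, then \<open>Z\<close> is at least 5, and at least 6 in the
    triangle-free case. If it is 4, then \<open>Z\<close> is at least 3, and at least 4 in the
    triangle-free case. For \<open>chi\<close> at most 3 the inequalities \<open>chi \<le> Z +
    1\<close> and \<open>2 \<le> \<omega>\<close> are enough.\<close>
  have "2 * chi \<le> \<omega> + Z + 2"
  proof -
    have "chi = 0 \<or> chi = 1 \<or> chi = 2 \<or> chi = 3 \<or> chi = 4 \<or> chi = 5" using five by linarith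
    moreover have "\<omega> < 3 \<and> Z \<le> 3 \<longrightarrow> chi \<le> 3" "\<omega> < 3 \<and> Z \<le> 5 \<longrightarrow> chi \<le> 4"
      using triangle_free[of 3] triangle_free[of 4] by auto
    ultimately show ?thesis using greedy four edgeless by linarith
  qed
  then have "real (2 * chi) \<le> real (\<omega> + Z + 2)" by (simp only: of_nat_le_iff)
  then show ?thesis
    unfolding chi_def[symmetric] \<omega>_def[symmetric] Z_def[symmetric] le_ceiling_iff by simp
qed

end
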